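(* Let $\mathfrak{g}=\mathfrak{sl}_2(\mathbb{C})$. (i) For all $b\in\mathbb{C}$, the formulas given in the context define on $M_b$ and on $M_b'$ the structure of $\mathfrak{sl}_2$-modules. (ii) The set of modules $$\{F_{(a,1)}(M_b)\mid a\in\mathbb{C}^*,\ b\in\mathbb{C}\}\ \cup\ \{F_{(a,1)}(M_b')\mid a\in\mathbb{C}^*,\ b\in\mathbb{C}_{\ge -\frac12}\}\ \cup\ \{F_{(a,1)}\circ F_\tau(M_b')\mid a\in\mathbb{C}^*,\ b\in\mathbb{C}_{\ge-\frac12}\},$$ where $\mathbb{C}_{\ge-\frac12}=\{z\in\mathbb{C}\mid \mathrm{Re}(z)\ge-\frac12\}$, is a skeleton of $\mathcal{M}$.
   Context: $e_{i,j}$ are matrix units, $h:=\frac12(e_{1,1}-e_{2,2})$, $\mathfrak{h}=\mathbb{C}h$, and $\mathcal{U}(\mathfrak{h})=\mathbb{C}[h]$. $\mathcal{M}$ is the full subcategory of the category of $\mathcal{U}(\mathfrak{sl}_2)$-modules consisting of modules whose restriction to $\mathcal{U}(\mathfrak{h})$ is free of rank $1$. Let $\sigma$ be the algebra automorphism of $\mathbb{C}[h]$ with $\sigma(h)=h-1$. For $b\in\mathbb{C}$, $M_b$ is the vector space $\mathbb{C}[h]$ with $h\cdot f=hf$, $e_{1,2}\cdot f=(h+b)\sigma f$, $e_{2,1}\cdot f=-(h-b)\sigma^{-1}f$. Similarly $M_b'$ is the vector space $\mathbb{C}[h]$ with $h\cdot f=hf$, $e_{1,2}\cdot f=\sigma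 f$, $e_{2,1}\cdot f=-(h+b+1)(h-b)\sigma^{-1}f$. Every automorphism $\varphi$ of $\mathcal{U}(\mathfrak{sl}_2)$ gives a functor $F_\varphi$ sending a module to the same vector space with new action $x\bullet v:=\varphi(x)\cdot v$ (and morphisms to themselves). $F_\tau$ is the functor for the automorphism $\tau$ with $\tau(e_{i,j})=-e_{j,i}$ (so $\tau(h)=-h$), and for $a=(a_1,a_2)\in(\mathbb{C}^* )^2$, $F_a$ is the functor for the automorphism $\varphi_a$ with $\varphi_a(e_{i,j})=\frac{a_i}{a_j}e_{i,j}$ (so $\varphi_a(h)=h$). A set of objects is a skeleton of $\mathcal{M}$ if every object of $\mathcal{M}$ is isomorphic to exactly one module in the set; modules that coincide (same vector space and same action) are one element of the set. *)

theory Defs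
  imports
    "HOL-Analysis.Analysis"
    "HOL-Library.Poly_Mapping"
    "HOL-Computational_Algebra.Polynomial"
begin

section \<open>The Lie algebra $\mathfrak{sl}_2(\mathbb{C})$\<close>

typedef sl2 = "{A :: complex^2^2. trace A = 0}"
  morphisms mat_of_sl2 Abs_sl2
proof
  show "0 \<in> {A :: complex^2^2. trace A = 0}" by (simp add: trace_def)
qed

setup_lifting type_definition_sl2

instantiation sl2 :: ab_group_add
begin

lift_definition zero_sl2 :: sl2 is 0
  by (simp add: trace_def)

lift_definition plus_sl2 :: "sl2 \<Rightarrow> sl2 \<Rightarrow> sl2" is "(+)"
  by (simp add: trace_add)

lift_definition minus_sl2 :: "sl2 \<Rightarrow> sl2 \<Rightarrow> sl2" is "(-)"
  by (simp add: trace_sub)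

lift_definition uminus_sl2 :: "sl2 \<Rightarrow> sl2" is uminus
  by (simp add: trace_def sum_negf)

instance
proof
  fix x y z :: sl2
  show "x + y + z = x + (y + z)" by transfer (rule add.assoc)
  show "x + y = y + x" by transfer (rule add.commute)
  show "0 + x = x" by transfer (rule add_0_left)
  show "- x + x = 0" by transfer (rule left_minus)
  show "x - y = x + - y" by transfer (rule diff_conv_add_uminus)
qed

end

lift_definition sl2_scale :: "complex \<Rightarrow> sl2 \<Rightarrow> sl2" is "\<lambda>c A. \<chi> i j. c * A $ i $ j"
  by (simp add: trace_def flip: sum_distrib_left)

lift_definition sl2_bracket :: "sl2 \<Rightarrow> sl2 \<Rightarrow> sl2" is "\<lambda>A B. A ** B - B ** A"
  by (metis trace_sub trace_mul_sym right_minus_eq)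

definition mat_unit :: "2 \<Rightarrow> 2 \<Rightarrow> complex^2^2" where
  "mat_unit i j = (\<chi> k l. if k = i \<and> l = j then 1 else 0)"

lift_definition sl2_e12 :: sl2 is "mat_unit 1 2"
  by (simp add: trace_def mat_unit_def sum_2)

lift_definition sl2_e21 :: sl2 is "mat_unit 2 1"
  by (simp add: trace_def mat_unit_def sum_2)

lift_definition sl2_h :: sl2 is "(1 / 2) *\<^sub>R (mat_unit 1 1 - mat_unit 2 2)"
  by (simp add: trace_def mat_unit_def sum_2)


section \<open>The universal enveloping algebra\<close>

text \<open>
  The free unital complex algebra on the set of elements of $\mathfrak{sl}_2$ is the monoid algebra
  of the free monoid, that is, finitely supported functions on words with the convolution product.
  \<open>Poly_Mapping\<close> expects the monoid to be written additively, so \<open>+\<close> on words is concatenation.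
\<close>

datatype sl2_word = Word (letters: "sl2 list")

instantiation sl2_word :: monoid_add
begin

definition zero_sl2_word :: sl2_word where "0 = Word []"

definition plus_sl2_word :: "sl2_word \<Rightarrow> sl2_word \<Rightarrow> sl2_word"
  where "v + w = Word (letters v @ letters w)"

instance
  by standard (simp_all add: zero_sl2_word_def plus_sl2_word_def)

end

type_synonym sl2_free_alg = "sl2_word \<Rightarrow>\<^sub>0 complex"

definition free_scalar :: "complex \<Rightarrow> sl2_free_alg" where
  "free_scalar c = Poly_Mapping.single 0 c"

definition free_gen :: "sl2 \<Rightarrow> sl2_free_alg" where
  "free_gen x = Poly_Mapping.single (Word [x]) 1"

text \<open>
  The relators of the first two kinds make the inclusion of generators linear (so that one obtains
  the tensor algebra); the third kind identifies the bracket with the commutator.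
\<close>

inductive_set usl2_relators :: "sl2_free_alg set" where
  "free_gen (x + y) - (free_gen x + free_gen y) \<in> usl2_relators"
| "free_gen (sl2_scale c x) - free_scalar c * free_gen x \<in> usl2_relators"
| "free_gen (sl2_bracket x y) - (free_gen x * free_gen y - free_gen y * free_gen x)
    \<in> usl2_relators"

inductive_set usl2_ideal :: "sl2_free_alg set" where
  usl2_ideal_zero: "0 \<in> usl2_ideal"
| usl2_ideal_add: "p \<in> usl2_ideal \<Longrightarrow> q \<in> usl2_ideal \<Longrightarrow> p + q \<in> usl2_ideal"
| usl2_ideal_gen: "r \<in> usl2_relators \<Longrightarrow> p * r * q \<in> usl2_ideal"

lemma usl2_ideal_mult_left: "r \<in> usl2_ideal \<Longrightarrow> p * r \<in> usl2_ideal"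
proof (induction rule: usl2_ideal.induct)
  case (usl2_ideal_gen r q s)
  then show ?case
    using usl2_ideal.usl2_ideal_gen[of r "p * q" s] by (simp add: mult.assoc)
qed (auto simp: distrib_left intro: usl2_ideal.intros)

lemma usl2_ideal_mult_right: "r \<in> usl2_ideal \<Longrightarrow> r * p \<in> usl2_ideal"
proof (induction rule: usl2_ideal.induct)
  case (usl2_ideal_gen r q s)
  then show ?case
    using usl2_ideal.usl2_ideal_gen[of r q "s * p"] by (simp add: mult.assoc)
qed (auto simp: distrib_right intro: usl2_ideal.intros)

lemma usl2_ideal_uminus: "r \<in> usl2_ideal \<Longrightarrow> - r \<in> usl2_ideal"
  using usl2_ideal_mult_left[of r "- 1"] by simp

lemma usl2_ideal_diff: "p \<in> usl2_ideal \<Longrightarrow> q \<in> usl2_ideal \<Longrightarrow> p - q \<in> usl2_ideal"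
  using usl2_ideal_add[of p "- q"] usl2_ideal_uminus[of q] by simp

lemma usl2_relators_subset: "r \<in> usl2_relators \<Longrightarrow> r \<in> usl2_ideal"
  using usl2_ideal_gen[of r 1 1] by simp

lemma free_alg_induct [case_names single add]:
  fixes p :: sl2_free_alg
  assumes "\<And>w c. P (Poly_Mapping.single w c)"
    and "\<And>p q. P p \<Longrightarrow> P q \<Longrightarrow> P (p + q)"
  shows "P p"
proof (induction p rule: Poly_Mapping.update_induct)
  case const
  show ?case using assms(1)[of 0 0] by simp
next
  case (update p w c)
  have "Poly_Mapping.update w c p = p + Poly_Mapping.single w c"
    using update.hyps(1)
    by (intro poly_mapping_eqI) (auto simp: lookup_add lookup_single lookup_update when_def in_keys_iff)
  with assms update.IH show ?case by simp
qed


subsection \<open>Representations of the free algebra\<close>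

definition word_act :: "(sl2 \<Rightarrow> 'v \<Rightarrow> 'v) \<Rightarrow> sl2_word \<Rightarrow> 'v \<Rightarrow> 'v" where
  "word_act \<rho> w = foldr \<rho> (letters w)"

definition free_act ::
    "(complex \<Rightarrow> 'v \<Rightarrow> 'v) \<Rightarrow> (sl2 \<Rightarrow> 'v \<Rightarrow> 'v) \<Rightarrow> sl2_free_alg \<Rightarrow> 'v::ab_group_add \<Rightarrow> 'v" where
  "free_act s \<rho> p v = (\<Sum>w\<in>Poly_Mapping.keys p. s (Poly_Mapping.lookup p w) (word_act \<rho> w v))"

locale sl2_lie_module = vector_space s
  for s :: "complex \<Rightarrow> 'v::ab_group_add \<Rightarrow> 'v" +
  fixes \<rho> :: "sl2 \<Rightarrow> 'v \<Rightarrow> 'v"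
  assumes act_add: "\<rho> x (v + w) = \<rho> x v + \<rho> x w"
    and act_scale: "\<rho> x (s c v) = s c (\<rho> x v)"
    and add_act: "\<rho> (x + y) v = \<rho> x v + \<rho> y v"
    and scale_act: "\<rho> (sl2_scale c x) v = s c (\<rho> x v)"
    and bracket_act: "\<rho> (sl2_bracket x y) v = \<rho> x (\<rho> y v) - \<rho> y (\<rho> x v)"
begin

lemma word_act_add: "word_act \<rho> w (u + v) = word_act \<rho> w u + word_act \<rho> w v"
proof -
  have "foldr \<rho> xs (u + v) = foldr \<rho> xs u + foldr \<rho> xs v" for xs
    by (induction xs) (auto simp: act_add)
  then show ?thesis by (simp add: word_act_def)
qed

lemma word_act_scale: "word_act \<rho> w (s c v) = s c (word_act \<rho> w v)"
proof -
  have "foldr \<rho> xs (s c v) = s c (foldr \<rho> xs v)" for xs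
    by (induction xs) (auto simp: act_scale)
  then show ?thesis by (simp add: word_act_def)
qed

lemma word_act_plus: "word_act \<rho> (w + w') v = word_act \<rho> w (word_act \<rho> w' v)"
  by (simp add: word_act_def plus_sl2_word_def)

lemma word_act_zero: "word_act \<rho> 0 v = v"
  by (simp add: word_act_def zero_sl2_word_def)

lemma free_act_single: "free_act s \<rho> (Poly_Mapping.single w c) v = s c (word_act \<rho> w v)"
  by (cases "c = 0") (simp_all add: free_act_def)

lemma free_act_superset:
  assumes "finite K" "Poly_Mapping.keys p \<subseteq> K"
  shows "free_act s \<rho> p v = (\<Sum>w\<in>K. s (Poly_Mapping.lookup p w) (word_act \<rho> w v))"
  unfolding free_act_def using assms
  by (intro sum.mono_neutral_left) (auto simp: in_keys_iff)

lemma free_act_plus: "free_act s \<rho> (p + q) v = free_act s \<rho> p v + free_act s \<rho> q v"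
proof -
  let ?K = "Poly_Mapping.keys p \<union> Poly_Mapping.keys q"
  have "free_act s \<rho> (p + q) v = (\<Sum>w\<in>?K. s (Poly_Mapping.lookup (p + q) w) (word_act \<rho> w v))"
    by (intro free_act_superset) (auto simp: Poly_Mapping.keys_add)
  also have "\<dots> = free_act s \<rho> p v + free_act s \<rho> q v"
    by (simp add: free_act_superset[of ?K p] free_act_superset[of ?K q]
        lookup_add scale_left_distrib sum.distrib)
  finally show ?thesis .
qed

lemma free_act_add: "free_act s \<rho> p (u + v) = free_act s \<rho> p u + free_act s \<rho> p v"
  by (simp add: free_act_def word_act_add scale_right_distrib sum.distrib)

lemma free_act_scale: "free_act s \<rho> p (s c v) = s c (free_act s \<rho> p v)"
  by (simp add: free_act_def word_act_scale scale_sum_right mult.commute)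

lemma free_act_mult: "free_act s \<rho> (p * q) v = free_act s \<rho> p (free_act s \<rho> q v)"
proof (induction p rule: free_alg_induct)
  case (single w c)
  show ?case
  proof (induction q rule: free_alg_induct)
    case (single w' d)
    show ?case
      by (simp add: mult_single free_act_single word_act_plus word_act_scale)
  next
    case (add p q)
    then show ?case by (simp add: distrib_left free_act_plus free_act_add)
  qed
next
  case (add p q)
  then show ?case by (simp add: distrib_right free_act_plus)
qed

lemma free_act_0: "free_act s \<rho> 0 v = 0"
  by (simp add: free_act_def)

lemma free_act_zero: "free_act s \<rho> p 0 = 0"
  using free_act_add[of p 0 0] by simp

lemma free_act_diff: "free_act s \<rho> (p - q) v = free_act s \<rho> p v - free_act s \<rho> q v"
  using free_act_plus[of "p - q" q v] by (simp add: algebra_simps)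

lemma free_act_gen: "free_act s \<rho> (free_gen x) v = \<rho> x v"
  by (simp add: free_gen_def free_act_single word_act_def)

lemma free_act_scalar: "free_act s \<rho> (free_scalar c) v = s c v"
  by (simp add: free_scalar_def free_act_single word_act_zero)

lemma free_act_relator: "r \<in> usl2_relators \<Longrightarrow> free_act s \<rho> r v = 0"
  by (induction rule: usl2_relators.induct)
    (simp_all add: free_act_diff free_act_plus free_act_mult free_act_gen free_act_scalar
      add_act scale_act bracket_act)

lemma free_act_ideal: "r \<in> usl2_ideal \<Longrightarrow> free_act s \<rho> r v = 0"
  by (induction arbitrary: v rule: usl2_ideal.induct)
    (simp_all add: free_act_0 free_act_plus free_act_mult free_act_relator free_act_zero)

end

lemma one_notin_usl2_ideal: "1 \<notin> usl2_ideal"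
proof
  interpret sl2_lie_module "(*)" "\<lambda>x v. 0 :: complex"
    by unfold_locales (auto simp: algebra_simps)
  assume "1 \<in> usl2_ideal"
  then have "free_act (*) (\<lambda>x v. 0 :: complex) 1 1 = 0"
    by (rule free_act_ideal)
  moreover have "free_act (*) (\<lambda>x v. 0 :: complex) 1 1 = 1"
    using free_act_scalar[of 1 1] by (simp add: free_scalar_def)
  ultimately show False by simp
qed


subsection \<open>The quotient algebra\<close>

quotient_type usl2 = sl2_free_alg / "\<lambda>p q. p - q \<in> usl2_ideal"
proof (rule equivpI)
  show "reflp (\<lambda>p q. p - q \<in> usl2_ideal)"
    by (simp add: reflp_def usl2_ideal_zero)
  show "symp (\<lambda>p q. p - q \<in> usl2_ideal)"
    using usl2_ideal_uminus by (force simp: symp_def)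
  show "transp (\<lambda>p q. p - q \<in> usl2_ideal)"
    using usl2_ideal_add by (fastforce simp: transp_def)
qed

instantiation usl2 :: ring_1
begin

lift_definition zero_usl2 :: usl2 is 0 .

lift_definition one_usl2 :: usl2 is 1 .

lift_definition plus_usl2 :: "usl2 \<Rightarrow> usl2 \<Rightarrow> usl2" is "(+)"
proof -
  fix p q p' q' :: sl2_free_alg
  assume "p - q \<in> usl2_ideal" "p' - q' \<in> usl2_ideal"
  then have "(p - q) + (p' - q') \<in> usl2_ideal" by (rule usl2_ideal_add)
  then show "p + p' - (q + q') \<in> usl2_ideal" by (simp only: add_diff_add)
qed

lift_definition minus_usl2 :: "usl2 \<Rightarrow> usl2 \<Rightarrow> usl2" is "(-)"
proof -
  fix p q p' q' :: sl2_free_alg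
  assume "p - q \<in> usl2_ideal" "p' - q' \<in> usl2_ideal"
  then have "(p - q) - (p' - q') \<in> usl2_ideal" by (rule usl2_ideal_diff)
  moreover have "(p - q) - (p' - q') = p - p' - (q - q')" by (simp add: algebra_simps)
  ultimately show "p - p' - (q - q') \<in> usl2_ideal" by metis
qed

lift_definition uminus_usl2 :: "usl2 \<Rightarrow> usl2" is uminus
proof -
  fix p q :: sl2_free_alg
  assume "p - q \<in> usl2_ideal"
  then have "- (p - q) \<in> usl2_ideal" by (rule usl2_ideal_uminus)
  moreover have "- (p - q) = - p - - q" by simp
  ultimately show "- p - - q \<in> usl2_ideal" by metis
qed

lift_definition times_usl2 :: "usl2 \<Rightarrow> usl2 \<Rightarrow> usl2" is "(*)"
proof -
  fix p q p' q' :: sl2_free_alg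
  assume "p - q \<in> usl2_ideal" "p' - q' \<in> usl2_ideal"
  then have "(p - q) * p' + q * (p' - q') \<in> usl2_ideal"
    by (intro usl2_ideal_add usl2_ideal_mult_left usl2_ideal_mult_right)
  moreover have "(p - q) * p' + q * (p' - q') = p * p' - q * q'" by (simp add: algebra_simps)
  ultimately show "p * p' - q * q' \<in> usl2_ideal" by metis
qed

instance
proof
  show "(0 :: usl2) \<noteq> 1"
    using one_notin_usl2_ideal usl2_ideal_uminus[of "- 1"] by transfer auto
  fix a b c :: usl2
  show "a * b * c = a * (b * c)" by transfer (simp add: mult.assoc usl2_ideal_zero)
  show "1 * a = a" by transfer (simp add: usl2_ideal_zero)
  show "a * 1 = a" by transfer (simp add: usl2_ideal_zero)
  show "(a + b) * c = a * c + b * c" by transfer (simp add: distrib_right usl2_ideal_zero)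
  show "a * (b + c) = a * b + a * c" by transfer (simp add: distrib_left usl2_ideal_zero)
  show "a + b + c = a + (b + c)" by transfer (simp add: add.assoc usl2_ideal_zero)
  show "a + b = b + a" by transfer (simp add: add.commute usl2_ideal_zero)
  show "0 + a = a" by transfer (simp add: usl2_ideal_zero)
  show "- a + a = 0" by transfer (simp add: usl2_ideal_zero)
  show "a - b = a + - b" by transfer (simp add: usl2_ideal_zero)
qed

end

lift_definition usl2_scalar :: "complex \<Rightarrow> usl2" is free_scalar .

lift_definition usl2_gen :: "sl2 \<Rightarrow> usl2" is free_gen .

abbreviation U_h :: usl2 where "U_h \<equiv> usl2_gen sl2_h"
abbreviation U_e12 :: usl2 where "U_e12 \<equiv> usl2_gen sl2_e12"
abbreviation U_e21 :: usl2 where "U_e21 \<equiv> usl2_gen sl2_e21"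


section \<open>Modules over the enveloping algebra\<close>

text \<open>
  A module is given by its action on an abelian group, whose underlying set is a whole type.
  Complex scalars act through \<open>usl2_scalar\<close>, so the maps in \<open>usl2_iso\<close> are complex linear.
\<close>

type_synonym 'v usl2_action = "usl2 \<Rightarrow> 'v \<Rightarrow> 'v"

locale usl2_module =
  fixes act :: "'v::ab_group_add usl2_action"
  assumes act_right_distrib: "act u (v + w) = act u v + act u w"
    and act_left_distrib: "act (u + u') v = act u v + act u' v"
    and act_mult: "act (u * u') v = act u (act u' v)"
    and act_one: "act 1 v = v"

definition usl2_iso :: "'v::ab_group_add usl2_action \<Rightarrow> 'w::ab_group_add usl2_action \<Rightarrow> bool" where
  "usl2_iso act act' \<longleftrightarrow>
    (\<exists>f. bij f \<and> (\<forall>v w. f (v + w) = f v + f w) \<and> (\<forall>u v. f (act u v) = act' u (f v)))"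

text \<open>The inclusion of $\mathcal{U}(\mathfrak{h}) = \mathbb{C}[h]$, and restriction along it.\<close>

definition usl2_of_poly :: "complex poly \<Rightarrow> usl2" where
  "usl2_of_poly p = (\<Sum>i\<le>Polynomial.degree p. usl2_scalar (coeff p i) * U_h ^ i)"

definition restrict_h :: "'v usl2_action \<Rightarrow> complex poly \<Rightarrow> 'v \<Rightarrow> 'v" where
  "restrict_h act p = act (usl2_of_poly p)"

definition free_of_rank :: "nat \<Rightarrow> ('r::comm_ring_1 \<Rightarrow> 'v::ab_group_add \<Rightarrow> 'v) \<Rightarrow> bool" where
  "free_of_rank n s \<longleftrightarrow> module s \<and>
    (\<exists>B. finite B \<and> card B = n \<and> \<not> module.dependent s B \<and> module.span s B = UNIV)"

text \<open>The objects of the category $\mathcal{M}$.\<close>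

definition cat_M :: "'v::ab_group_add usl2_action set" where
  "cat_M = {act. usl2_module act \<and> free_of_rank 1 (restrict_h act)}"

text \<open>
  The candidate modules in \<open>S\<close> live on the fixed type \<open>'w\<close>, the modules to be classified on an
  arbitrary type \<open>'v\<close>; two elements of \<open>S\<close> are equal iff they have the same action.
\<close>

definition is_skeleton_M ::
    "'v::ab_group_add itself \<Rightarrow> 'w::ab_group_add usl2_action set \<Rightarrow> bool" where
  "is_skeleton_M _ S \<longleftrightarrow>
    S \<subseteq> cat_M \<and> (\<forall>act \<in> (cat_M :: 'v usl2_action set). \<exists>!N. N \<in> S \<and> usl2_iso act N)"


section \<open>Twisting by automorphisms\<close>

definition usl2_automorphism :: "(usl2 \<Rightarrow> usl2) \<Rightarrow> bool" where
  "usl2_automorphism \<phi> \<longleftrightarrow> bij \<phi> \<and> \<phi> 1 = 1 \<and> (\<forall>c. \<phi> (usl2_scalar c) = usl2_scalar c) \<and>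
    (\<forall>u v. \<phi> (u + v) = \<phi> u + \<phi> v) \<and> (\<forall>u v. \<phi> (u * v) = \<phi> u * \<phi> v)"

definition twist :: "(usl2 \<Rightarrow> usl2) \<Rightarrow> 'v usl2_action \<Rightarrow> 'v usl2_action" where
  "twist \<phi> act = (\<lambda>u v. act (\<phi> u) v)"

text \<open>
  Automorphisms are determined by their values on the basis $e_{1,2}, e_{2,1}, h$ of
  $\mathfrak{sl}_2$; see \<open>tau_ex1\<close> and \<open>phi_ex1\<close> below for existence and uniqueness.
\<close>

definition is_tau :: "(usl2 \<Rightarrow> usl2) \<Rightarrow> bool" where
  "is_tau \<phi> \<longleftrightarrow> usl2_automorphism \<phi> \<and> \<phi> U_e12 = - U_e21 \<and> \<phi> U_e21 = - U_e12 \<and> \<phi> U_h = - U_h"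

definition tau :: "usl2 \<Rightarrow> usl2" where
  "tau = (THE \<phi>. is_tau \<phi>)"

definition is_phi :: "complex \<times> complex \<Rightarrow> (usl2 \<Rightarrow> usl2) \<Rightarrow> bool" where
  "is_phi a \<phi> \<longleftrightarrow> usl2_automorphism \<phi> \<and>
    \<phi> U_e12 = usl2_scalar (fst a / snd a) * U_e12 \<and>
    \<phi> U_e21 = usl2_scalar (snd a / fst a) * U_e21 \<and> \<phi> U_h = U_h"

definition phi :: "complex \<times> complex \<Rightarrow> usl2 \<Rightarrow> usl2" where
  "phi a = (THE \<phi>. is_phi a \<phi>)"


subsection \<open>Existence and uniqueness of the automorphisms\<close>

lemma free_scalar_central: "free_scalar c * p = p * free_scalar c"
proof (induction p rule: free_alg_induct)
  case (single w d)
  show ?case by (simp add: free_scalar_def mult_single mult.commute)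
qed (simp add: algebra_simps)

lemma usl2_scalar_central: "usl2_scalar c * u = u * usl2_scalar c"
  by transfer (simp add: free_scalar_central usl2_ideal_zero)

lemma free_scalar_simps:
  "free_scalar (c + d) = free_scalar c + free_scalar d"
  "free_scalar (c * d) = free_scalar c * free_scalar d"
  "free_scalar 1 = 1"
  by (simp_all add: free_scalar_def single_add mult_single)

lemma usl2_scalar_simps:
  "usl2_scalar (c + d) = usl2_scalar c + usl2_scalar d"
  "usl2_scalar (c * d) = usl2_scalar c * usl2_scalar d"
  "usl2_scalar 1 = 1"
  by (transfer; simp add: free_scalar_simps usl2_ideal_zero)+

lemma usl2_gen_simps:
  "usl2_gen (x + y) = usl2_gen x + usl2_gen y"
  "usl2_gen (sl2_scale c x) = usl2_scalar c * usl2_gen x"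
  "usl2_gen (sl2_bracket x y) = usl2_gen x * usl2_gen y - usl2_gen y * usl2_gen x"
  by (transfer; simp add: usl2_relators_subset usl2_relators.intros)+

lemma sl2_decomp:
  obtains c d e where "x = sl2_scale c sl2_h + sl2_scale d sl2_e12 + sl2_scale e sl2_e21"
proof -
  have "\<exists>c d e. x = sl2_scale c sl2_h + sl2_scale d sl2_e12 + sl2_scale e sl2_e21"
  proof (transfer, goal_cases)
    case (1 A)
    then have "A $ 2 $ 2 = - A $ 1 $ 1"
      by (simp add: trace_def sum_2 eq_neg_iff_add_eq_0 add.commute)
    then show ?case
      by (intro exI[of _ "2 * A $ 1 $ 1"] exI[of _ "A $ 1 $ 2"] exI[of _ "A $ 2 $ 1"])
        (auto simp: vec_eq_iff forall_2 mat_unit_def scaleR_conv_of_real[where 'a = complex])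
  qed
  with that show thesis by blast
qed

lemma usl2_induct [case_names scalar gen add mult]:
  assumes "\<And>c. P (usl2_scalar c)"
    and "\<And>x. P (usl2_gen x)"
    and "\<And>u v. P u \<Longrightarrow> P v \<Longrightarrow> P (u + v)"
    and "\<And>u v. P u \<Longrightarrow> P v \<Longrightarrow> P (u * v)"
  shows "P u"
proof -
  have word: "P (abs_usl2 (Poly_Mapping.single (Word xs) c))" for xs c
  proof (induction xs)
    case Nil
    show ?case
      using assms(1)[of c] by (simp add: usl2_scalar_def free_scalar_def zero_sl2_word_def)
  next
    case (Cons x xs)
    have "Poly_Mapping.single (Word (x # xs)) c = free_gen x * Poly_Mapping.single (Word xs) c"
      by (simp add: free_gen_def mult_single plus_sl2_word_def)
    then show ?case
      using assms(4)[OF assms(2)[of x] Cons] by (simp add: usl2_gen_def times_usl2.abs_eq)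
  qed
  have "P (abs_usl2 p)" for p
  proof (induction p rule: free_alg_induct)
    case (single w c)
    then show ?case using word by (cases w) simp
  next
    case (add p q)
    then show ?case using assms(3) by (simp flip: plus_usl2.abs_eq)
  qed
  then show ?thesis by (metis Quotient_abs_rep[OF Quotient_usl2])
qed

definition usl2_hom :: "(usl2 \<Rightarrow> usl2) \<Rightarrow> bool" where
  "usl2_hom \<phi> \<longleftrightarrow> \<phi> 1 = 1 \<and> (\<forall>c. \<phi> (usl2_scalar c) = usl2_scalar c) \<and>
    (\<forall>u v. \<phi> (u + v) = \<phi> u + \<phi> v) \<and> (\<forall>u v. \<phi> (u * v) = \<phi> u * \<phi> v)"

lemma usl2_hom_eqI:
  assumes "usl2_hom \<phi>" "usl2_hom \<psi>"
    and "\<phi> U_h = \<psi> U_h" "\<phi> U_e12 = \<psi> U_e12" "\<phi> U_e21 = \<psi> U_e21"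
  shows "\<phi> = \<psi>"
proof
  fix u
  show "\<phi> u = \<psi> u"
  proof (induction u rule: usl2_induct)
    case (scalar c)
    show ?case using assms(1,2) by (simp add: usl2_hom_def)
  next
    case (gen x)
    obtain c d e where "x = sl2_scale c sl2_h + sl2_scale d sl2_e12 + sl2_scale e sl2_e21"
      by (rule sl2_decomp)
    with assms show ?case by (simp add: usl2_hom_def usl2_gen_simps)
  qed (use assms in \<open>simp_all add: usl2_hom_def\<close>)
qed

lemma usl2_hom_exists:
  assumes "\<And>x y. g (x + y) = g x + g y"
    and "\<And>c x. g (sl2_scale c x) = usl2_scalar c * g x"
    and "\<And>x y. g (sl2_bracket x y) = g x * g y - g y * g x"
  shows "\<exists>\<phi>. usl2_hom \<phi> \<and> (\<forall>x. \<phi> (usl2_gen x) = g x)"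
proof -
  let ?s = "\<lambda>c u. usl2_scalar c * u" and ?r = "\<lambda>x u. g x * u"
  interpret sl2_lie_module ?s ?r
  proof unfold_locales
    fix x c and u :: usl2
    show "g x * (usl2_scalar c * u) = usl2_scalar c * (g x * u)"
      by (metis mult.assoc usl2_scalar_central)
  qed (simp_all add: distrib_left distrib_right left_diff_distrib mult.assoc usl2_scalar_simps assms)
  define \<phi> where "\<phi> u = free_act ?s ?r (rep_usl2 u) 1" for u
  have abs: "\<phi> (abs_usl2 p) = free_act ?s ?r p 1" for p
  proof -
    have "rep_usl2 (abs_usl2 p) - p \<in> usl2_ideal"
      using Quotient_rep_abs[OF Quotient_usl2] by (simp add: usl2_ideal_zero)
    then show ?thesis
      using free_act_ideal free_act_diff unfolding \<phi>_def by (metis eq_iff_diff_eq_0)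
  qed
  have right: "free_act ?s ?r p (u * v) = free_act ?s ?r p u * v" for p u v
  proof -
    have "word_act ?r w (u * v) = word_act ?r w u * v" for w
    proof -
      have "foldr ?r xs (u * v) = foldr ?r xs u * v" for xs
        by (induction xs) (auto simp: mult.assoc)
      then show ?thesis by (simp add: word_act_def)
    qed
    then show ?thesis by (simp add: free_act_def sum_distrib_right mult.assoc)
  qed
  have abs_ex: "\<exists>p. u = abs_usl2 p" for u
    by (metis Quotient_abs_rep[OF Quotient_usl2])
  have add: "\<phi> (u + v) = \<phi> u + \<phi> v" for u v
    using abs_ex[of u] abs_ex[of v] by (auto simp: plus_usl2.abs_eq abs free_act_plus)
  have mult: "\<phi> (u * v) = \<phi> u * \<phi> v" for u v
  proof -
    obtain p q where "u = abs_usl2 p" "v = abs_usl2 q"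
      using abs_ex by metis
    then show ?thesis
      using right[of p 1 "free_act ?s ?r q 1"] by (simp add: times_usl2.abs_eq abs free_act_mult)
  qed
  have scalar: "\<phi> (usl2_scalar c) = usl2_scalar c" for c
    using abs[of "free_scalar c"] free_act_scalar[of c 1] by (simp add: usl2_scalar.abs_eq)
  have one: "\<phi> 1 = 1"
    using scalar[of 1] by (simp add: usl2_scalar_simps)
  have gen: "\<phi> (usl2_gen x) = g x" for x
    using abs[of "free_gen x"] free_act_gen[of x 1] by (simp add: usl2_gen.abs_eq)
  from add mult scalar one gen show ?thesis
    unfolding usl2_hom_def by (intro exI[of _ \<phi>]) auto
qed

lemma usl2_hom_id: "usl2_hom id"
  by (simp add: usl2_hom_def)

lemma usl2_hom_comp: "usl2_hom \<phi> \<Longrightarrow> usl2_hom \<psi> \<Longrightarrow> usl2_hom (\<phi> \<circ> \<psi>)"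
  by (simp add: usl2_hom_def)

lemma usl2_hom_uminus: "usl2_hom \<phi> \<Longrightarrow> \<phi> (- u) = - \<phi> u"
proof -
  assume "usl2_hom \<phi>"
  then have add: "\<phi> (u + v) = \<phi> u + \<phi> v" for u v
    by (simp add: usl2_hom_def)
  from add[of u "- u"] add[of 0 0] show ?thesis
    by (simp add: eq_neg_iff_add_eq_0 add.commute)
qed

lemma usl2_automorphism_iff: "usl2_automorphism \<phi> \<longleftrightarrow> bij \<phi> \<and> usl2_hom \<phi>"
  by (auto simp: usl2_automorphism_def usl2_hom_def)

lift_definition sl2_neg_transpose :: "sl2 \<Rightarrow> sl2" is "\<lambda>A. - transpose A"
  by (simp add: trace_def transpose_def sum_negf)

lift_definition sl2_conj :: "complex \<Rightarrow> sl2 \<Rightarrow> sl2" is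
  "\<lambda>t A. \<chi> i j. (if i = j then 1 else if i = 1 then t else inverse t) * A $ i $ j"
  by (simp add: trace_def)

lemma tau_ex1: "\<exists>!\<phi>. is_tau \<phi>"
proof -
  have "\<exists>\<phi>. usl2_hom \<phi> \<and> (\<forall>x. \<phi> (usl2_gen x) = usl2_gen (sl2_neg_transpose x))"
  proof (rule usl2_hom_exists)
    fix x y c
    have "sl2_neg_transpose (x + y) = sl2_neg_transpose x + sl2_neg_transpose y"
      by transfer (simp add: vec_eq_iff transpose_def)
    then show "usl2_gen (sl2_neg_transpose (x + y)) =
        usl2_gen (sl2_neg_transpose x) + usl2_gen (sl2_neg_transpose y)"
      by (simp add: usl2_gen_simps)
    have "sl2_neg_transpose (sl2_scale c x) = sl2_scale c (sl2_neg_transpose x)"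
      by transfer (simp add: vec_eq_iff transpose_def)
    then show "usl2_gen (sl2_neg_transpose (sl2_scale c x)) =
        usl2_scalar c * usl2_gen (sl2_neg_transpose x)"
      by (simp add: usl2_gen_simps)
    have "sl2_neg_transpose (sl2_bracket x y) =
        sl2_bracket (sl2_neg_transpose x) (sl2_neg_transpose y)"
      by transfer (simp add: vec_eq_iff transpose_def matrix_matrix_mult_def sum_2 forall_2 algebra_simps)
    then show "usl2_gen (sl2_neg_transpose (sl2_bracket x y)) =
        usl2_gen (sl2_neg_transpose x) * usl2_gen (sl2_neg_transpose y) -
        usl2_gen (sl2_neg_transpose y) * usl2_gen (sl2_neg_transpose x)"
      by (simp add: usl2_gen_simps)
  qed
  then obtain \<phi> where \<phi>: "usl2_hom \<phi>"
    and gen: "\<And>x. \<phi> (usl2_gen x) = usl2_gen (sl2_neg_transpose x)"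
    by blast
  have basis: "sl2_neg_transpose sl2_e12 = sl2_scale (-1) sl2_e21"
    "sl2_neg_transpose sl2_e21 = sl2_scale (-1) sl2_e12"
    "sl2_neg_transpose sl2_h = sl2_scale (-1) sl2_h"
    by (transfer; simp add: vec_eq_iff forall_2 transpose_def mat_unit_def)+
  have "usl2_scalar (-1) * u = - u" for u
  proof -
    have "usl2_scalar (-1) * u + u = usl2_scalar (-1 + 1) * u"
      by (simp only: usl2_scalar_simps distrib_right mult_1_left)
    also have "usl2_scalar (-1 + 1) = 0"
      using usl2_scalar_simps(1)[of 0 0] by simp
    finally show ?thesis by (simp add: eq_neg_iff_add_eq_0)
  qed
  then have vals: "\<phi> U_e12 = - U_e21" "\<phi> U_e21 = - U_e12" "\<phi> U_h = - U_h"
    by (simp_all add: gen basis usl2_gen_simps)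
  have "\<phi> \<circ> \<phi> = id"
    using \<phi> by (intro usl2_hom_eqI usl2_hom_comp usl2_hom_id) (simp_all add: vals usl2_hom_uminus)
  then have "bij \<phi>" by (rule o_bij) fact
  with \<phi> vals have ex: "is_tau \<phi>" by (simp add: is_tau_def usl2_automorphism_iff)
  moreover have "\<psi> = \<phi>" if "is_tau \<psi>" for \<psi>
    using that ex by (intro usl2_hom_eqI) (auto simp: is_tau_def usl2_automorphism_iff)
  ultimately show ?thesis by blast
qed

lemma phi_ex1:
  assumes "fst a \<noteq> 0" "snd a \<noteq> 0"
  shows "\<exists>!\<phi>. is_phi a \<phi>"
proof -
  have ex: "\<exists>\<phi>. usl2_hom \<phi> \<and> \<phi> U_e12 = usl2_scalar t * U_e12 \<and>
      \<phi> U_e21 = usl2_scalar (inverse t) * U_e21 \<and> \<phi> U_h = U_h" if t: "t \<noteq> 0" for t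
  proof -
    have "\<exists>\<phi>. usl2_hom \<phi> \<and> (\<forall>x. \<phi> (usl2_gen x) = usl2_gen (sl2_conj t x))"
    proof (rule usl2_hom_exists)
      fix x y c
      have "sl2_conj t (x + y) = sl2_conj t x + sl2_conj t y"
        by transfer (simp add: vec_eq_iff algebra_simps)
      then show "usl2_gen (sl2_conj t (x + y)) = usl2_gen (sl2_conj t x) + usl2_gen (sl2_conj t y)"
        by (simp add: usl2_gen_simps)
      have "sl2_conj t (sl2_scale c x) = sl2_scale c (sl2_conj t x)"
        by transfer (simp add: vec_eq_iff)
      then show "usl2_gen (sl2_conj t (sl2_scale c x)) = usl2_scalar c * usl2_gen (sl2_conj t x)"
        by (simp add: usl2_gen_simps)
      have "sl2_conj t (sl2_bracket x y) = sl2_bracket (sl2_conj t x) (sl2_conj t y)"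
        using t
        by transfer
          (simp add: vec_eq_iff forall_2 matrix_matrix_mult_def sum_2, simp add: field_simps)
      then show "usl2_gen (sl2_conj t (sl2_bracket x y)) =
          usl2_gen (sl2_conj t x) * usl2_gen (sl2_conj t y) -
          usl2_gen (sl2_conj t y) * usl2_gen (sl2_conj t x)"
        by (simp add: usl2_gen_simps)
    qed
    then obtain \<phi> where \<phi>: "usl2_hom \<phi>" and gen: "\<And>x. \<phi> (usl2_gen x) = usl2_gen (sl2_conj t x)"
      by blast
    have basis: "sl2_conj t sl2_e12 = sl2_scale t sl2_e12"
      "sl2_conj t sl2_e21 = sl2_scale (inverse t) sl2_e21" "sl2_conj t sl2_h = sl2_h"
      by (transfer; simp add: vec_eq_iff forall_2 mat_unit_def)+
    show ?thesis
      by (intro exI[of _ \<phi>]) (simp add: \<phi> gen basis usl2_gen_simps)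
  qed
  let ?t = "fst a / snd a"
  have t: "?t \<noteq> 0" "inverse ?t \<noteq> 0" using assms by auto
  obtain \<phi> where \<phi>: "usl2_hom \<phi>" "\<phi> U_e12 = usl2_scalar ?t * U_e12"
    "\<phi> U_e21 = usl2_scalar (inverse ?t) * U_e21" "\<phi> U_h = U_h"
    using ex[OF t(1)] by blast
  obtain \<psi> where \<psi>: "usl2_hom \<psi>" "\<psi> U_e12 = usl2_scalar (inverse ?t) * U_e12"
    "\<psi> U_e21 = usl2_scalar ?t * U_e21" "\<psi> U_h = U_h"
    using ex[OF t(2)] by (metis inverse_inverse_eq)
  have scal: "usl2_hom \<theta> \<Longrightarrow> \<theta> (usl2_scalar c * u) = usl2_scalar c * \<theta> u" for \<theta> c u
    by (simp add: usl2_hom_def)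
  have cancel: "usl2_scalar c * (usl2_scalar d * u) = u" if "c * d = 1" for c d u
    using that by (metis mult.assoc mult_1_left usl2_scalar_simps(2,3))
  have inv: "?t * inverse ?t = 1" "inverse ?t * ?t = 1" using t by auto
  have "\<phi> \<circ> \<psi> = id" "\<psi> \<circ> \<phi> = id"
    by (intro usl2_hom_eqI usl2_hom_comp usl2_hom_id \<phi> \<psi>;
        simp only: o_apply id_apply \<phi> \<psi> scal[OF \<phi>(1)] scal[OF \<psi>(1)] cancel[OF inv(1)] cancel[OF inv(2)])+
  then have "bij \<phi>" using o_bij by blast
  with \<phi> have phi: "is_phi a \<phi>" by (simp add: is_phi_def usl2_automorphism_iff)
  moreover have "\<theta> = \<phi>" if "is_phi a \<theta>" for \<theta>
    using that phi by (intro usl2_hom_eqI) (auto simp: is_phi_def usl2_automorphism_iff)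
  ultimately show ?thesis by blast
qed


section \<open>The modules $M_b$ and $M'_b$\<close>

definition sigma :: "complex poly \<Rightarrow> complex poly" where
  "sigma f = pcompose f [:-1, 1:]"

definition is_M :: "complex \<Rightarrow> complex poly usl2_action \<Rightarrow> bool" where
  "is_M b act \<longleftrightarrow> usl2_module act \<and>
    (\<forall>c f. act (usl2_scalar c) f = smult c f) \<and>
    (\<forall>f. act U_h f = [:0, 1:] * f) \<and>
    (\<forall>f. act U_e12 f = [:b, 1:] * sigma f) \<and>
    (\<forall>f. act U_e21 f = - ([:-b, 1:] * inv sigma f))"

definition is_M' :: "complex \<Rightarrow> complex poly usl2_action \<Rightarrow> bool" where
  "is_M' b act \<longleftrightarrow> usl2_module act \<and>
    (\<forall>c f. act (usl2_scalar c) f = smult c f) \<and>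
    (\<forall>f. act U_h f = [:0, 1:] * f) \<and>
    (\<forall>f. act U_e12 f = sigma f) \<and>
    (\<forall>f. act U_e21 f = - ([:b + 1, 1:] * [:-b, 1:] * inv sigma f))"

text \<open>
  Since $h, e_{1,2}, e_{2,1}$ span $\mathfrak{sl}_2$, at most one module structure on
  $\mathbb{C}[h]$ satisfies the formulas; that one exists is part of the theorem.
\<close>

definition mod_M :: "complex \<Rightarrow> complex poly usl2_action" where
  "mod_M b = (THE act. is_M b act)"

definition mod_M' :: "complex \<Rightarrow> complex poly usl2_action" where
  "mod_M' b = (THE act. is_M' b act)"

end

(*
  Transporting a rank one free module along its generator gives C[h] with h acting by multiplication.
  The commutation relations with h force e12 f = p sigma(f) and e21 f = q sigma^-1(f), where p and q
  are the images of 1, and [e12, e21] = 2h becomes p sigma(q) - q sigma^-1(p) = 2h. An isomorphism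
  between two such modules is multiplication by a unit of C[h], a constant, so (p, q) is a complete
  isomorphism invariant. The relation says that p sigma(q) + h^2 - h is shift invariant, hence
  constant, so p sigma(q) = -(h + b)(h - b - 1) for some b, where b and -b-1 are interchangeable and
  one of them has real part at least -1/2. The degree 0, 1, 2 of p then decides between the families
  M'_b, M_b and the twist of M'_b by tau.
*)
theory Submission
  imports Defs
begin

section \<open>The shift automorphism\<close>

lemma inv_sigma: "inv sigma = (\<lambda>f. pcompose f [:1, 1:])"
  by (rule inv_unique_comp)
    (auto simp: sigma_def fun_eq_iff pcompose_pCons simp flip: pcompose_assoc)

lemma sigma_inv_sigma: "sigma (inv sigma f) = f" "inv sigma (sigma f) = f"
  by (simp_all add: inv_sigma sigma_def pcompose_pCons flip: pcompose_assoc)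

lemma sigma_simps:
  "sigma (f + g) = sigma f + sigma g" "sigma (f * g) = sigma f * sigma g"
  "sigma (smult c f) = smult c (sigma f)" "sigma (pCons c f) = [:c:] + [:-1, 1:] * sigma f"
  "sigma 0 = 0" "sigma 1 = 1" "sigma (- f) = - sigma f"
  by (simp_all add: sigma_def pcompose_add pcompose_mult pcompose_smult pcompose_pCons pcompose_uminus pcompose_1)

lemma inv_sigma_simps:
  "inv sigma (f + g) = inv sigma f + inv sigma g" "inv sigma (f * g) = inv sigma f * inv sigma g"
  "inv sigma (smult c f) = smult c (inv sigma f)"
  "inv sigma (pCons c f) = [:c:] + [:1, 1:] * inv sigma f"
  "inv sigma 0 = 0" "inv sigma 1 = 1" "inv sigma (- f) = - inv sigma f"
  by (simp_all add: inv_sigma pcompose_add pcompose_mult pcompose_smult pcompose_pCons pcompose_uminus pcompose_1)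

text \<open>Invariance carries the value at \<open>0\<close> to every natural number, so subtracting
  that value leaves a polynomial with infinitely many roots.\<close>

lemma shift_invariant_poly_const:
  assumes "inv sigma f = f"
  obtains c where "f = [:c:]"
proof -
  have "poly f (of_nat n) = poly f 0" for n
  proof (induction n)
    case (Suc n)
    have "poly f (of_nat (Suc n)) = poly (inv sigma f) (of_nat n)"
      by (simp add: inv_sigma poly_pcompose add.commute)
    with Suc show ?case by (simp add: assms)
  qed simp
  then have "range of_nat \<subseteq> {x. poly (f - [:poly f 0:]) x = 0}"
    by auto
  moreover have "infinite (range (of_nat :: nat \<Rightarrow> complex))"
    by (rule range_inj_infinite) (rule inj_of_nat)
  ultimately have "f - [:poly f 0:] = 0"
    using poly_roots_finite infinite_super by blast
  then show thesis using that[of "poly f 0"] by simp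
qed


section \<open>Commutation relations and generators\<close>

lemma sl2_brackets:
  "sl2_bracket sl2_h sl2_e12 = sl2_e12"
  "sl2_bracket sl2_h sl2_e21 = sl2_scale (-1) sl2_e21"
  "sl2_bracket sl2_e12 sl2_e21 = sl2_scale 2 sl2_h"
  by (transfer; simp add: vec_eq_iff forall_2 matrix_matrix_mult_def sum_2 mat_unit_def
      scaleR_conv_of_real[where 'a = complex])+

lemma usl2_commutators:
  "U_e12 = U_h * U_e12 - U_e12 * U_h"
  "usl2_scalar (-1) * U_e21 = U_h * U_e21 - U_e21 * U_h"
  "usl2_scalar 2 * U_h = U_e12 * U_e21 - U_e21 * U_e12"
  using sl2_brackets by (metis usl2_gen_simps(2,3))+

context usl2_module
begin

lemma act_zero: "act u 0 = 0"
  using act_right_distrib[of u 0 0] by simp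

lemma zero_act: "act 0 v = 0"
  using act_left_distrib[of 0 0 v] by simp

lemma minus_act: "act (- u) v = - act u v"
  using act_left_distrib[of u "- u" v] by (simp add: zero_act eq_neg_iff_add_eq_0 add.commute)

lemma diff_act: "act (u - u') v = act u v - act u' v"
  using act_left_distrib[of u "- u'" v] by (simp add: minus_act)

lemma act_scalar_commute: "act u (act (usl2_scalar c) v) = act (usl2_scalar c) (act u v)"
  by (metis act_mult usl2_scalar_central)

lemma scalar_minus_one_act: "act (usl2_scalar (-1)) v = - v"
proof -
  have "act (usl2_scalar 0) v = 0"
    using usl2_scalar_simps(1)[of 0 0] by (simp add: zero_act)
  then have "act (usl2_scalar (-1)) v + v = 0"
    using act_left_distrib[of "usl2_scalar (-1)" "usl2_scalar 1" v]
      usl2_scalar_simps(1)[of "-1" 1] by (simp add: usl2_scalar_simps(3) act_one)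
  then show ?thesis by (simp add: eq_neg_iff_add_eq_0)
qed

text \<open>The first two equations move \<open>U_h\<close> to the outside, the direction needed
  when a polynomial in h is built up coefficient by coefficient.\<close>

lemma act_U_commute:
  "act U_e12 (act U_h v) = act U_h (act U_e12 v) - act U_e12 v"
  "act U_e21 (act U_h v) = act U_h (act U_e21 v) + act U_e21 v"
  "act U_e12 (act U_e21 v) - act U_e21 (act U_e12 v) = act (usl2_scalar 2) (act U_h v)"
  using arg_cong[OF usl2_commutators(1), of "\<lambda>u. act u v"]
    arg_cong[OF usl2_commutators(2), of "\<lambda>u. act u v"]
    arg_cong[OF usl2_commutators(3), of "\<lambda>u. act u v"]
  by (simp_all add: diff_act act_mult scalar_minus_one_act algebra_simps eq_diff_eq)

end

text \<open>Every element of the Lie algebra is a linear combination of h, \<open>e12\<close> and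
  \<open>e21\<close>, and the elements commuting with \<open>f\<close> are closed under sums and
  products. Hence the generators suffice.\<close>

lemma usl2_intertwiner:
  assumes "usl2_module act" "usl2_module act'"
    and add: "\<And>v w. f (v + w) = f v + f w"
    and scal: "\<And>c v. f (act (usl2_scalar c) v) = act' (usl2_scalar c) (f v)"
    and gens: "\<And>v. f (act U_h v) = act' U_h (f v)" "\<And>v. f (act U_e12 v) = act' U_e12 (f v)"
      "\<And>v. f (act U_e21 v) = act' U_e21 (f v)"
  shows "f (act u v) = act' u (f v)"
proof -
  interpret A: usl2_module act by fact
  interpret B: usl2_module act' by fact
  show ?thesis
  proof (induction u arbitrary: v rule: usl2_induct)
    case (gen x)
    obtain c d e where "x = sl2_scale c sl2_h + sl2_scale d sl2_e12 + sl2_scale e sl2_e21"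
      by (rule sl2_decomp)
    then show ?case
      by (simp add: usl2_gen_simps A.act_left_distrib A.act_mult B.act_left_distrib B.act_mult
          add scal gens)
  qed (simp_all add: scal add A.act_left_distrib A.act_mult B.act_left_distrib B.act_mult)
qed

lemma usl2_action_eqI:
  assumes "usl2_module act" "usl2_module act'"
    and "\<And>c v. act (usl2_scalar c) v = act' (usl2_scalar c) v"
    and "\<And>v. act U_h v = act' U_h v" "\<And>v. act U_e12 v = act' U_e12 v"
      "\<And>v. act U_e21 v = act' U_e21 v"
  shows "act = act'"
  using usl2_intertwiner[OF assms(1,2), of "\<lambda>v. v"] assms(3-) by (simp add: fun_eq_iff)

lemma usl2_module_twist:
  assumes "usl2_module act" "usl2_hom \<phi>"
  shows "usl2_module (twist \<phi> act)"
  using assms by (simp add: usl2_module_def twist_def usl2_hom_def)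

text \<open>Universal property of the enveloping algebra: the action of the free algebra kills the
  defining ideal, so any representative of a class may be used.\<close>

lemma (in sl2_lie_module) usl2_module_exists:
  "\<exists>act. usl2_module act \<and> (\<forall>c v. act (usl2_scalar c) v = s c v) \<and>
    (\<forall>x v. act (usl2_gen x) v = \<rho> x v)"
proof -
  define act where "act u = free_act s \<rho> (rep_usl2 u)" for u
  have abs: "act (abs_usl2 p) v = free_act s \<rho> p v" for p v
  proof -
    have "rep_usl2 (abs_usl2 p) - p \<in> usl2_ideal"
      using Quotient_rep_abs[OF Quotient_usl2] by (simp add: usl2_ideal_zero)
    then show ?thesis
      using free_act_ideal free_act_diff unfolding act_def by (metis eq_iff_diff_eq_0)
  qed
  have abs_ex: "\<exists>p. u = abs_usl2 p" for u
    by (metis Quotient_abs_rep[OF Quotient_usl2])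
  have "usl2_module act"
  proof
    fix u u' v w
    obtain p q where pq: "u = abs_usl2 p" "u' = abs_usl2 q"
      using abs_ex by metis
    show "act u (v + w) = act u v + act u w" "act (u + u') v = act u v + act u' v"
      "act (u * u') v = act u (act u' v)"
      by (simp_all add: pq plus_usl2.abs_eq times_usl2.abs_eq abs free_act_add free_act_plus
          free_act_mult)
    show "act 1 v = v"
      using free_act_scalar[of 1 v] by (simp add: one_usl2.abs_eq abs free_scalar_simps(3))
  qed
  moreover have "act (usl2_scalar c) v = s c v" "act (usl2_gen x) v = \<rho> x v" for c v x
    by (simp_all add: usl2_scalar.abs_eq usl2_gen.abs_eq abs free_act_scalar free_act_gen)
  ultimately show ?thesis by blast
qed


section \<open>Module structures on the polynomial ring\<close>

text \<open>A trace zero matrix is \<open>x11\<close> times \<open>2h\<close> plus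
  \<open>x12\<close> times \<open>e12\<close> plus \<open>x21\<close> times \<open>e21\<close>; the
  factor 2 compensates the one half in h. The root vectors act by \<open>p\<close> times
  \<open>sigma\<close> and \<open>q\<close> times its inverse.\<close>

definition pq_rep :: "complex poly \<Rightarrow> complex poly \<Rightarrow> sl2 \<Rightarrow> complex poly \<Rightarrow> complex poly" where
  "pq_rep p q x f = smult (2 * mat_of_sl2 x $ 1 $ 1) ([:0, 1:] * f) +
    smult (mat_of_sl2 x $ 1 $ 2) (p * sigma f) + smult (mat_of_sl2 x $ 2 $ 1) (q * inv sigma f)"

text \<open>
  \<open>H\<close> stands for $h$, a prefix \<open>S\<close> or \<open>T\<close> for an application of $\sigma$ or $\sigma^{-1}$, and
  \<open>a, b, c\<close> and \<open>a', b', c'\<close> for the entries at $(1,1)$, $(1,2)$, $(2,1)$ of two trace zero matrices.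
  With these as opaque ring elements the bracket identity is a polynomial consequence of the relation.
\<close>

lemma pq_rep_bracket:
  fixes H P Q SP SQ TP TQ f Sf Tf SSf TTf a b c a' b' c' :: "complex poly"
  assumes "P * SQ - Q * TP = 2 * H"
  shows "2 * (b * c' - b' * c) * (H * f) + (2 * a * b' - 2 * a' * b) * (P * Sf)
      + (2 * c * a' - 2 * c' * a) * (Q * Tf) =
    (2 * a * (H * (2 * a' * (H * f) + b' * (P * Sf) + c' * (Q * Tf)))
      + b * (P * (2 * a' * ((H - 1) * Sf) + b' * (SP * SSf) + c' * (SQ * f)))
      + c * (Q * (2 * a' * ((H + 1) * Tf) + b' * (TP * f) + c' * (TQ * TTf)))) -
    (2 * a' * (H * (2 * a * (H * f) + b * (P * Sf) + c * (Q * Tf)))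
      + b' * (P * (2 * a * ((H - 1) * Sf) + b * (SP * SSf) + c * (SQ * f)))
      + c' * (Q * (2 * a * ((H + 1) * Tf) + b * (TP * f) + c * (TQ * TTf))))"
  using assms by algebra

text \<open>Only the bracket axiom uses the relation. Both shifts fix constants and move h by one,
  so pushing them through products reduces the axiom to \<open>pq_rep_bracket\<close>.\<close>

lemma sl2_lie_module_pq_rep:
  assumes rel: "p * sigma q - q * inv sigma p = [:0, 2:]"
  shows "sl2_lie_module smult (pq_rep p q)"
proof (intro sl2_lie_module.intro sl2_lie_module_axioms.intro)
  show "vector_space (smult :: complex \<Rightarrow> _)"
    by unfold_locales (simp_all add: smult_add_left smult_add_right)
  fix x y and v w :: "complex poly" and c
  show "pq_rep p q x (v + w) = pq_rep p q x v + pq_rep p q x w"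
    "pq_rep p q x (smult c v) = smult c (pq_rep p q x v)"
    by (simp_all add: pq_rep_def sigma_simps inv_sigma_simps algebra_simps smult_add_right)
  show "pq_rep p q (x + y) v = pq_rep p q x v + pq_rep p q y v"
    "pq_rep p q (sl2_scale c x) v = smult c (pq_rep p q x v)"
    by (simp_all add: pq_rep_def plus_sl2.rep_eq sl2_scale.rep_eq algebra_simps smult_add_right
        smult_add_left)
  have tr: "mat_of_sl2 z $ 2 $ 2 = - mat_of_sl2 z $ 1 $ 1" for z
    using mat_of_sl2[of z] by (simp add: trace_def sum_2 eq_neg_iff_add_eq_0 add.commute)
  have ent: "mat_of_sl2 (sl2_bracket x y) $ 1 $ 1 =
      mat_of_sl2 x $ 1 $ 2 * mat_of_sl2 y $ 2 $ 1 - mat_of_sl2 y $ 1 $ 2 * mat_of_sl2 x $ 2 $ 1"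
    "mat_of_sl2 (sl2_bracket x y) $ 1 $ 2 =
      2 * mat_of_sl2 x $ 1 $ 1 * mat_of_sl2 y $ 1 $ 2 - 2 * mat_of_sl2 y $ 1 $ 1 * mat_of_sl2 x $ 1 $ 2"
    "mat_of_sl2 (sl2_bracket x y) $ 2 $ 1 =
      2 * mat_of_sl2 x $ 2 $ 1 * mat_of_sl2 y $ 1 $ 1 - 2 * mat_of_sl2 y $ 2 $ 1 * mat_of_sl2 x $ 1 $ 1"
    by (simp_all add: sl2_bracket.rep_eq matrix_matrix_mult_def sum_2 tr)
  \<comment> \<open>Matrix entries become constant polynomials, so that the bracket axiom is an
    identity in a single commutative ring.\<close>
  let ?k = "\<lambda>i j z. [:mat_of_sl2 z $ i $ j:]"
  let ?H = "[:0, 1:] :: complex poly"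
  have two: "[:2:] = (2 :: complex poly)" by (simp add: numeral_poly)
  have rep: "pq_rep p q z f = 2 * ?k 1 1 z * (?H * f) + ?k 1 2 z * (p * sigma f)
      + ?k 2 1 z * (q * inv sigma f)" for z f
  proof -
    have "2 * ?k 1 1 z = [:2 * mat_of_sl2 z $ 1 $ 1:]"
      unfolding mult_2 by simp
    then show ?thesis by (simp add: pq_rep_def)
  qed
  have shift: "sigma (?k i j z) = ?k i j z" "inv sigma (?k i j z) = ?k i j z"
    "sigma ?H = ?H - 1" "inv sigma ?H = ?H + 1" "sigma 2 = 2" "inv sigma 2 = 2" for i j z
    by (simp_all add: sigma_simps inv_sigma_simps one_pCons flip: two)
  have rel': "p * sigma q - q * inv sigma p = 2 * ?H"
    using rel by (simp flip: two)
  have br: "?k 1 1 (sl2_bracket x y) = ?k 1 2 x * ?k 2 1 y - ?k 1 2 y * ?k 2 1 x"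
    "?k 1 2 (sl2_bracket x y) = 2 * ?k 1 1 x * ?k 1 2 y - 2 * ?k 1 1 y * ?k 1 2 x"
    "?k 2 1 (sl2_bracket x y) = 2 * ?k 2 1 x * ?k 1 1 y - 2 * ?k 2 1 y * ?k 1 1 x"
    unfolding ent by (simp_all flip: two)
  have S: "sigma (pq_rep p q z v) = 2 * ?k 1 1 z * ((?H - 1) * sigma v)
      + ?k 1 2 z * (sigma p * sigma (sigma v)) + ?k 2 1 z * (sigma q * v)" for z
    unfolding rep by (simp only: sigma_simps(1,2) shift sigma_inv_sigma)
  have T: "inv sigma (pq_rep p q z v) = 2 * ?k 1 1 z * ((?H + 1) * inv sigma v)
      + ?k 1 2 z * (inv sigma p * v) + ?k 2 1 z * (inv sigma q * inv sigma (inv sigma v))" for z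
    unfolding rep by (simp only: inv_sigma_simps(1,2) shift sigma_inv_sigma)
  show "pq_rep p q (sl2_bracket x y) v =
      pq_rep p q x (pq_rep p q y v) - pq_rep p q y (pq_rep p q x v)"
    unfolding rep[of x "pq_rep p q y v"] rep[of y "pq_rep p q x v"] S T
    unfolding rep br by (rule pq_rep_bracket[OF rel'])
qed

lemma ex1_poly_action:
  assumes "p * sigma q - q * inv sigma p = [:0, 2:]"
  shows "\<exists>!act. usl2_module act \<and> (\<forall>c f. act (usl2_scalar c) f = smult c f) \<and>
    (\<forall>f. act U_h f = [:0, 1:] * f) \<and> (\<forall>f. act U_e12 f = p * sigma f) \<and>
    (\<forall>f. act U_e21 f = q * inv sigma f)"
    (is "\<exists>!act. ?P act")
proof -
  obtain act where act: "usl2_module act" "\<And>c v. act (usl2_scalar c) v = smult c v"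
    "\<And>x v. act (usl2_gen x) v = pq_rep p q x v"
    using sl2_lie_module.usl2_module_exists[OF sl2_lie_module_pq_rep[OF assms]] by metis
  have "?P act"
    by (simp add: act pq_rep_def sl2_h.rep_eq sl2_e12.rep_eq sl2_e21.rep_eq mat_unit_def
        scaleR_conv_of_real[where 'a = complex])
  moreover have "act' = act''" if "?P act'" "?P act''" for act' act''
    using that by (intro usl2_action_eqI) auto
  ultimately show ?thesis by blast
qed

section \<open>Existence of the modules M_b and M'_b, and coincidences among the latter\<close>

lemma M_relation:
  "[:b, 1:] * sigma (- [:-b, 1:]) - (- [:-b, 1:]) * inv sigma [:b, 1:] = [:0, 2:]"
  by (simp add: sigma_simps inv_sigma_simps)

lemma M'_relation:
  "1 * sigma (- ([:b + 1, 1:] * [:-b, 1:])) - (- ([:b + 1, 1:] * [:-b, 1:])) * inv sigma 1 = [:0, 2:]"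
  by (simp add: sigma_simps inv_sigma_simps algebra_simps)

lemma ex1_is_M: "\<exists>!act. is_M b act"
  using ex1_poly_action[OF M_relation[of b]] unfolding is_M_def by (simp only: minus_mult_left)

lemma ex1_is_M': "\<exists>!act. is_M' b act"
  using ex1_poly_action[OF M'_relation[of b]]
  unfolding is_M'_def by (simp only: minus_mult_left mult_1_left)

lemma is_M_mod_M: "is_M b (mod_M b)"
  unfolding mod_M_def by (rule theI'[OF ex1_is_M])

lemma is_M'_mod_M': "is_M' b (mod_M' b)"
  unfolding mod_M'_def by (rule theI'[OF ex1_is_M'])

lemma mod_M'_reflect:
  assumes "b * (b + 1) = c * (c + 1)"
  shows "mod_M' b = mod_M' c"
proof -
  have "b + b * b = c + c * c"
    using assms by (simp add: algebra_simps)
  then have "[:b + 1, 1:] * [:-b, 1:] = [:c + 1, 1:] * [:-c, 1:]"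
    by (simp add: algebra_simps)
  then show ?thesis unfolding mod_M'_def is_M'_def by (simp only:)
qed

lemma is_tau_tau: "is_tau tau"
  unfolding tau_def by (rule theI'[OF tau_ex1])

lemma is_phi_phi: "a \<noteq> 0 \<Longrightarrow> is_phi (a, 1) (phi (a, 1))"
  unfolding phi_def by (rule theI'[OF phi_ex1]) simp_all


lemma smult_left_cancel:
  fixes f g :: "'a::field poly"
  assumes "c \<noteq> 0" "smult c f = smult c g"
  shows "f = g"
  using arg_cong[OF assms(2), of "smult (inverse c)"] assms(1) by simp


section \<open>Coordinates on the objects of the category\<close>

text \<open>Coordinates with respect to the generator \<open>F 1\<close>: \<open>p\<close> and
  \<open>q\<close> are the coordinates of its images under \<open>U_e12\<close> and
  \<open>U_e21\<close>. Compatibility is demanded for scalars and generators only.\<close>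

definition realizes ::
    "'v::ab_group_add usl2_action \<Rightarrow> complex poly \<Rightarrow> complex poly \<Rightarrow> (complex poly \<Rightarrow> 'v) \<Rightarrow> bool" where
  "realizes act p q F \<longleftrightarrow> bij F \<and> (\<forall>f g. F (f + g) = F f + F g) \<and>
    (\<forall>c f. F (smult c f) = act (usl2_scalar c) (F f)) \<and>
    (\<forall>f. F (pCons 0 f) = act U_h (F f)) \<and>
    (\<forall>f. F (p * sigma f) = act U_e12 (F f)) \<and>
    (\<forall>f. F (q * inv sigma f) = act U_e21 (F f))"

lemma usl2_scalar_0: "usl2_scalar 0 = 0"
  using usl2_scalar_simps(1)[of 0 0] by simp

lemma usl2_of_poly_0: "usl2_of_poly 0 = 0"
  by (simp add: usl2_of_poly_def usl2_scalar_0)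

text \<open>Horner's recursion, obtained by moving the central scalars past \<open>U_h\<close>; it
  replaces the sum in inductions on polynomials.\<close>

lemma usl2_of_poly_pCons: "usl2_of_poly (pCons a f) = usl2_scalar a + U_h * usl2_of_poly f"
proof (cases "f = 0")
  case True
  then show ?thesis by (simp add: usl2_of_poly_def usl2_scalar_0)
next
  case False
  have "U_h * (usl2_scalar c * u) = usl2_scalar c * (U_h * u)" for c u
    by (metis mult.assoc usl2_scalar_central)
  with False show ?thesis
    by (simp add: usl2_of_poly_def sum.atMost_Suc_shift sum_distrib_left del: sum.atMost_Suc)
qed

text \<open>For a basis vector \<open>v\<close>, the map sending \<open>f\<close> to
  \<open>f(h) v\<close> is bijective, and the commutation relations with h extend the images of
  \<open>v\<close> under the root vectors to all of C[h].\<close>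

lemma cat_M_realizes:
  assumes "act \<in> cat_M"
  obtains p q F where "realizes act p q F"
proof -
  from assms interpret usl2_module act by (simp add: cat_M_def)
  from assms interpret R: module "restrict_h act"
    by (simp add: cat_M_def free_of_rank_def)
  obtain B where B: "card B = 1" "\<not> R.dependent B" "R.span B = UNIV"
    using assms by (auto simp: cat_M_def free_of_rank_def)
  then obtain v where v: "B = {v}" by (auto simp: card_1_singleton_iff)
  define F where "F f = restrict_h act f v" for f
  have add: "F (f + g) = F f + F g" for f g
    by (simp add: F_def R.scale_left_distrib)
  have F_mult: "F (f * g) = restrict_h act f (F g)" for f g
    by (simp add: F_def)
  have const: "restrict_h act [:c:] w = act (usl2_scalar c) w" for c w
    by (simp add: restrict_h_def usl2_of_poly_pCons usl2_of_poly_0)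
  have var: "restrict_h act [:0, 1:] w = act U_h w" for w
    by (simp add: restrict_h_def usl2_of_poly_pCons usl2_of_poly_0 usl2_scalar_0 usl2_scalar_simps)
  have smult: "F (smult c f) = act (usl2_scalar c) (F f)" for c f
    using F_mult[of "[:c:]" f] by (simp add: const)
  have h: "F (pCons 0 f) = act U_h (F f)" for f
    using F_mult[of "[:0, 1:]" f] by (simp add: var)
  have F_pCons: "F (pCons a f) = act (usl2_scalar a) (F 1) + act U_h (F f)" for a f
  proof -
    have "pCons a f = smult a 1 + pCons 0 f" by (simp add: one_pCons)
    then show ?thesis by (simp only: add smult h)
  qed
  have F0: "F 0 = 0" using add[of 0 0] by simp
  have diff: "F (f - g) = F f - F g" for f g
    using add[of "f - g" g] by simp
  have F1: "F 1 = v" by (simp add: F_def)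
  have "surj F"
    using B(3) unfolding v R.span_singleton by (simp add: F_def)
  \<comment> \<open>A nonzero polynomial killing \<open>v\<close> would be a linear dependence of
    the basis.\<close>
  moreover have "inj F"
  proof (rule injI)
    fix f g assume "F f = F g"
    then have "restrict_h act (f - g) v = 0"
      using add[of "f - g" g] by (simp add: F_def)
    moreover have "R.dependent {v}" if "f - g \<noteq> 0" "restrict_h act (f - g) v = 0"
      unfolding R.dependent_finite[OF finite.intros(2)[OF finite.emptyI]]
      using that by (intro exI[of _ "\<lambda>_. f - g"]) simp
    ultimately show "f = g" using B(2) by (auto simp: v)
  qed
  ultimately have "bij F" by (simp add: bij_def)
  obtain p q where p: "act U_e12 v = F p" and q: "act U_e21 v = F q"
    using \<open>surj F\<close> by (metis surjD)
  \<comment> \<open>The induction matches \<open>sigma (h f) = (h - 1) sigma f\<close> with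
    \<open>e12 h = (h - 1) e12\<close>; for \<open>e21\<close> below, the shift is by
    \<open>+1\<close>.\<close>
  have e12: "F (p * sigma f) = act U_e12 (F f)" for f
  proof (induction f)
    case 0
    then show ?case by (simp add: F0 act_zero sigma_simps)
  next
    case (pCons a f)
    have "p * sigma (pCons a f) = smult a p + pCons 0 (p * sigma f) - p * sigma f"
      by (simp add: sigma_simps algebra_simps)
    then have "F (p * sigma (pCons a f)) =
        act (usl2_scalar a) (F p) + act U_h (F (p * sigma f)) - F (p * sigma f)"
      by (simp only: diff add smult h)
    also have "\<dots> = act U_e12 (F (pCons a f))"
      using F_pCons[of a f] pCons.IH
      by (simp add: F1 act_right_distrib act_scalar_commute act_U_commute p)
    finally show ?case .
  qed
  have e21: "F (q * inv sigma f) = act U_e21 (F f)" for f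
  proof (induction f)
    case 0
    then show ?case by (simp add: F0 act_zero inv_sigma_simps)
  next
    case (pCons a f)
    have "q * inv sigma (pCons a f) = smult a q + pCons 0 (q * inv sigma f) + q * inv sigma f"
      by (simp add: inv_sigma_simps algebra_simps)
    then have "F (q * inv sigma (pCons a f)) =
        act (usl2_scalar a) (F q) + act U_h (F (q * inv sigma f)) + F (q * inv sigma f)"
      by (simp only: add smult h)
    also have "\<dots> = act U_e21 (F (pCons a f))"
      using F_pCons[of a f] pCons.IH
      by (simp add: F1 act_right_distrib act_scalar_commute act_U_commute q)
    finally show ?case .
  qed
  show thesis
    using that[of p q F] \<open>bij F\<close> add smult h e12 e21 by (simp add: realizes_def)
qed

section \<open>Consequences of a choice of coordinates\<close>

context
  fixes act :: "'v::ab_group_add usl2_action" and p q F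
  assumes act_realizes: "realizes act p q F"
begin

lemma realizes_add: "F (f + g) = F f + F g"
  and realizes_smult: "F (smult c f) = act (usl2_scalar c) (F f)"
  and realizes_h: "F (pCons 0 f) = act U_h (F f)"
  and realizes_e12: "F (p * sigma f) = act U_e12 (F f)"
  and realizes_e21: "F (q * inv sigma f) = act U_e21 (F f)"
  and realizes_bij: "bij F"
  using act_realizes by (simp_all add: realizes_def)

lemma realizes_diff: "F (f - g) = F f - F g"
  using realizes_add[of "f - g" g] by simp

lemma realizes_mult:
  assumes "usl2_module act"
  shows "F (f * g) = restrict_h act f (F g)"
proof -
  interpret usl2_module act by fact
  show ?thesis
  proof (induction f)
    case 0
    show ?case
      using realizes_add[of 0 0] by (simp add: restrict_h_def usl2_of_poly_0 zero_act)
  next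
    case (pCons a f)
    then show ?case
      by (simp add: restrict_h_def usl2_of_poly_pCons act_left_distrib act_mult realizes_add
          realizes_smult realizes_h)
  qed
qed

text \<open>Converse of \<open>cat_M_realizes\<close>, with basis \<open>{F 1}\<close>. The module
  laws over C[h] are read off from multiplication of polynomials through \<open>F\<close>.\<close>

lemma realizes_in_cat_M:
  assumes "usl2_module act"
  shows "act \<in> cat_M"
proof -
  interpret usl2_module act by fact
  note mult = realizes_mult[OF assms, symmetric]
  have F_inv: "\<exists>f. v = F f" for v
    using realizes_bij by (meson bij_pointE)
  interpret R: module "restrict_h act"
  proof
    fix f g and v w :: 'v
    obtain k where k: "v = F k" using F_inv by blast
    show "restrict_h act f (v + w) = restrict_h act f v + restrict_h act f w"
      by (simp add: restrict_h_def act_right_distrib)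
    show "restrict_h act (f + g) v = restrict_h act f v + restrict_h act g v"
      "restrict_h act f (restrict_h act g v) = restrict_h act (f * g) v"
      "restrict_h act 1 v = v"
      unfolding k mult by (simp_all add: distrib_right realizes_add mult.assoc)
  qed
  have F: "restrict_h act f (F 1) = F f" for f
    using mult[of f 1] by simp
  have "F 0 = 0" using realizes_add[of 0 0] by simp
  then have "F f = 0 \<longleftrightarrow> f = 0" for f
    using realizes_bij by (metis bij_def injD)
  then have "\<not> R.dependent {F 1}"
    unfolding R.dependent_finite[OF finite.intros(2)[OF finite.emptyI]] by (simp add: F)
  moreover have "R.span {F 1} = UNIV"
    unfolding R.span_singleton using realizes_bij by (simp add: F bij_def)
  ultimately show ?thesis
    using assms R.module_axioms unfolding cat_M_def free_of_rank_def
    by (auto intro!: exI[of _ "{F 1}"])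
qed

text \<open>Evaluate the relation $[e_{1,2}, e_{2,1}] = 2h$ on the generator.\<close>

lemma realizes_relation:
  assumes "usl2_module act"
  shows "p * sigma q - q * inv sigma p = [:0, 2:]"
proof -
  interpret usl2_module act by fact
  have "F (p * sigma q - q * inv sigma p) =
      act U_e12 (act U_e21 (F 1)) - act U_e21 (act U_e12 (F 1))"
    using realizes_e12[of 1] realizes_e21[of 1]
    by (simp add: realizes_diff realizes_e12 realizes_e21 sigma_simps inv_sigma_simps)
  also have "\<dots> = F (smult 2 (pCons 0 1))"
    by (simp only: act_U_commute realizes_smult realizes_h)
  finally show ?thesis
    using realizes_bij by (simp add: bij_def inj_eq one_pCons)
qed

text \<open>An isomorphism of $\mathbb{C}[h]$ with itself is multiplication by a nonzero constant.\<close>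

lemma realizes_unique:
  assumes "realizes act p' q' G"
  shows "p = p' \<and> q = q'"
proof -
  note G = assms[unfolded realizes_def]
  \<comment> \<open>The \<open>G\<close>-coordinate of the generator \<open>F 1\<close>; h-linearity
    then makes the change of coordinates multiplication by \<open>k\<close>.\<close>
  define k where "k = inv G (F 1)"
  have inj: "G x = G y \<longleftrightarrow> x = y" for x y
    using G by (simp add: bij_def inj_eq)
  have FG: "F f = G (f * k)" for f
  proof (induction f)
    case 0
    show ?case using realizes_add[of 0 0] G by (metis add_cancel_right_left mult_zero_left)
  next
    case (pCons a f)
    have "F (pCons a f) = F (smult a 1 + pCons 0 f)"
      by (simp add: one_pCons)
    also have "\<dots> = act (usl2_scalar a) (F 1) + act U_h (F f)"
      by (simp only: realizes_add realizes_smult realizes_h)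
    also have "F 1 = G k"
      using G by (simp add: k_def bij_def surj_f_inv_f)
    finally show ?case using G pCons.IH by simp
  qed
  \<comment> \<open>Surjectivity of \<open>F\<close> makes \<open>k\<close> a unit of C[h], hence a
    nonzero constant.\<close>
  obtain f where "F f = G 1" using realizes_bij by (metis bij_pointE)
  then have "f * k = 1" by (simp add: FG inj)
  then have "degree k = 0"
    by (metis dvd_triv_right is_unit_iff_degree mult_zero_right one_neq_zero)
  then obtain c where c: "k = [:c:]" by (rule degree_eq_zeroE)
  have "c \<noteq> 0" using c \<open>f * k = 1\<close> by auto
  \<comment> \<open>Compare the images of \<open>F 1\<close> under the root vectors; the shifts fix
    the constant \<open>k\<close>, which then cancels.\<close>
  have "G (p * k) = G (p' * sigma k)" "G (q * k) = G (q' * inv sigma k)"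
    using realizes_e12[of 1] realizes_e21[of 1] G
    by (simp_all add: FG sigma_simps inv_sigma_simps)
  then have "smult c p = smult c p'" "smult c q = smult c q'"
    by (simp_all add: inj c sigma_simps inv_sigma_simps)
  then show ?thesis
    using \<open>c \<noteq> 0\<close> by (metis smult_left_cancel)
qed

text \<open>The isomorphism is \<open>G\<close> after the inverse of \<open>F\<close>; it respects
  the generators because both sides have the same pair.\<close>

lemma realizes_iso:
  fixes act' :: "'w::ab_group_add usl2_action"
  assumes "usl2_module act" "usl2_module act'" "realizes act' p q G"
  shows "usl2_iso act act'"
proof -
  note G = assms(3)[unfolded realizes_def]
  have inv: "inv F (F f) = f" and F_inv: "F (inv F v) = v" for f v
    using realizes_bij by (simp_all add: bij_def surj_f_inv_f)
  define \<Phi> where "\<Phi> = G \<circ> inv F"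
  have \<Phi>: "\<Phi> (F f) = G f" for f by (simp add: \<Phi>_def inv)
  have "\<Phi> (v + w) = \<Phi> v + \<Phi> w" "\<Phi> (act (usl2_scalar c) v) = act' (usl2_scalar c) (\<Phi> v)"
    "\<Phi> (act U_h v) = act' U_h (\<Phi> v)" "\<Phi> (act U_e12 v) = act' U_e12 (\<Phi> v)"
    "\<Phi> (act U_e21 v) = act' U_e21 (\<Phi> v)" for v w c
  proof -
    obtain f g where [simp]: "v = F f" "w = F g" using F_inv by metis
    show "\<Phi> (v + w) = \<Phi> v + \<Phi> w" "\<Phi> (act (usl2_scalar c) v) = act' (usl2_scalar c) (\<Phi> v)"
      "\<Phi> (act U_h v) = act' U_h (\<Phi> v)" "\<Phi> (act U_e12 v) = act' U_e12 (\<Phi> v)"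
      "\<Phi> (act U_e21 v) = act' U_e21 (\<Phi> v)"
      using G by (simp_all add: \<Phi> flip: realizes_add realizes_smult realizes_h realizes_e12 realizes_e21)
  qed
  moreover have "bij \<Phi>"
    unfolding \<Phi>_def using G realizes_bij by (intro bij_comp bij_imp_bij_inv) auto
  ultimately show ?thesis
    unfolding usl2_iso_def using usl2_intertwiner[OF assms(1,2), of \<Phi>] by (intro exI[of _ \<Phi>]) simp
qed

text \<open>Together with \<open>realizes_unique\<close> this makes the pair an isomorphism
  invariant.\<close>

lemma realizes_transport:
  fixes act' :: "'w::ab_group_add usl2_action"
  assumes "usl2_iso act act'"
  obtains G where "realizes act' p q G"
proof -
  obtain \<Phi> where "bij \<Phi>" "\<And>v w. \<Phi> (v + w) = \<Phi> v + \<Phi> w" "\<And>u v. \<Phi> (act u v) = act' u (\<Phi> v)"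
    using assms by (auto simp: usl2_iso_def)
  then have "realizes act' p q (\<Phi> \<circ> F)"
    using act_realizes by (auto simp: realizes_def bij_comp)
  then show thesis by (rule that)
qed

end


section \<open>Classification of the pairs\<close>

lemma relation_product:
  assumes "p * sigma q - q * inv sigma p = [:0, 2:]"
  obtains b where "Re b \<ge> - 1/2" "p * sigma q = - ([:b, 1:] * [:- b - 1, 1:])"
proof -
  \<comment> \<open>The inverse shift lowers \<open>p * sigma q\<close> by \<open>2h\<close> and
    raises \<open>h^2 - h\<close> by \<open>2h\<close>, so the sum is invariant.\<close>
  let ?g = "p * sigma q + [:0, -1, 1:]"
  have "inv sigma ?g = ?g"
  proof -
    have "p * sigma q = q * inv sigma p + [:0, 2:]"
      using assms by (simp add: algebra_simps)
    then show ?thesis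
      unfolding inv_sigma_simps(1,2) sigma_inv_sigma by (simp add: inv_sigma_simps algebra_simps)
  qed
  then obtain c where c: "?g = [:c:]" by (rule shift_invariant_poly_const)
  \<comment> \<open>The equation \<open>b^2 + b = c\<close> has roots \<open>(-1 + r)/2\<close> and
    \<open>(-1 - r)/2\<close>. The principal square root has nonnegative real part, so the plus sign
    gives the required bound.\<close>
  define r where "r = csqrt (1 + 4 * c)"
  have r: "r * r = 1 + 4 * c" by (simp add: r_def flip: power2_eq_square)
  define b where "b = (r - 1) / 2"
  have "0 \<le> Re r" using csqrt_principal[of "1 + 4 * c"] by (auto simp: r_def)
  then have "Re b \<ge> - 1/2" by (simp add: b_def)
  moreover have "b * b + b = c"
    using r by (simp add: b_def field_simps)
  then have "p * sigma q = - ([:b, 1:] * [:- b - 1, 1:])"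
    using c[folded eq_diff_eq] by (simp add: algebra_simps)
  ultimately show thesis by (rule that)
qed

text \<open>The degrees of \<open>p\<close> and \<open>sigma q\<close> add up to 2, so the two
  linear factors of the product go both to \<open>sigma q\<close>, one to each, or both to
  \<open>p\<close>.\<close>

lemma relation_cases:
  assumes "p * sigma q - q * inv sigma p = [:0, 2:]"
  obtains a b where "a \<noteq> 0" "p = smult a [:b, 1:]" "q = smult (- 1 / a) [:-b, 1:]"
  | a b where "a \<noteq> 0" "Re b \<ge> - 1/2" "p = [:a:]" "q = smult (- 1 / a) ([:b + 1, 1:] * [:-b, 1:])"
  | a b where "a \<noteq> 0" "Re b \<ge> - 1/2" "p = smult a ([:b, 1:] * [:- b - 1, 1:])" "q = [:- 1 / a:]"
proof -
  obtain b where b: "Re b \<ge> - 1/2" and pq: "p * sigma q = - ([:b, 1:] * [:- b - 1, 1:])"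
    using relation_product[OF assms] .
  have q: "q = smult c (inv sigma g)" if "sigma q = smult c g" for c g
    using arg_cong[OF that, of "inv sigma"] by (simp add: inv_sigma_simps sigma_inv_sigma)
  have smult_neg: "smult (inverse a) (- g) = smult (- 1 / a) g" for a and g :: "complex poly"
    by (simp add: divide_inverse)
  have "p * sigma q \<noteq> 0" by (simp add: pq)
  then have "degree p + degree (sigma q) = degree (p * sigma q)"
    by (intro degree_mult_eq[symmetric]) auto
  also have "\<dots> = 2" by (simp add: pq)
  finally have deg: "degree p + degree (sigma q) = 2" .
  then consider "degree p = 0" | "degree p = 1" | "degree (sigma q) = 0" by linarith
  then show thesis
  proof cases
    case 1
    then obtain a where a: "p = [:a:]" by (rule degree_eq_zeroE)
    with pq have "a \<noteq> 0" by auto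
    have "smult (inverse a) (p * sigma q) = sigma q" using a \<open>a \<noteq> 0\<close> by simp
    then have "sigma q = smult (- 1 / a) ([:b, 1:] * [:- b - 1, 1:])"
      by (simp only: pq smult_neg)
    from q[OF this] have "q = smult (- 1 / a) ([:b + 1, 1:] * [:-b, 1:])"
      by (simp add: inv_sigma_simps algebra_simps)
    with that(2) a b \<open>a \<noteq> 0\<close> show thesis by blast
  next
    case 2
    then obtain u a where p: "p = [:u, a:]" "a \<noteq> 0"
      by (cases p) (force split: if_splits elim: degree_eq_zeroE)
    define c where "c = u / a"
    have pc: "p = smult a [:c, 1:]" using p by (simp add: c_def)
    \<comment> \<open>The root of \<open>p\<close> is a root of the product, which is symmetric
      under \<open>b -> -b - 1\<close>. Hence \<open>c\<close> can replace \<open>b\<close>, at the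
      price of the bound on the real part.\<close>
    have "poly (p * sigma q) (- c) = 0" by (simp add: pc)
    then have "poly [:b, 1:] (- c) = 0 \<or> poly [:- b - 1, 1:] (- c) = 0"
      by (simp only: pq poly_minus poly_mult neg_equal_0_iff_equal mult_eq_0_iff)
    then have "c = b \<or> c = - b - 1" by auto
    then have "[:b, 1:] * [:- b - 1, 1:] = [:c, 1:] * [:- c - 1, 1:]"
      by (elim disjE; simp)
    with pq pc have "[:c, 1:] * smult a (sigma q) = [:c, 1:] * (- [:- c - 1, 1:])"
      by (simp only: mult_smult_left mult_smult_right mult_minus_right)
    then have "smult a (sigma q) = - [:- c - 1, 1:]"
      by (simp only: mult_cancel_left) simp
    then have "smult (inverse a) (smult a (sigma q)) = smult (inverse a) (- [:- c - 1, 1:])"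
      by simp
    then have "sigma q = smult (- 1 / a) [:- c - 1, 1:]"
      using p(2) by (simp only: smult_neg) simp
    from q[OF this] have "q = smult (- 1 / a) [:-c, 1:]"
      by (simp add: inv_sigma_simps)
    with that(1) pc p(2) show thesis by blast
  next
    case 3
    then obtain d where d: "sigma q = [:d:]" by (rule degree_eq_zeroE)
    with pq have "d \<noteq> 0" by auto
    have "smult (inverse d) (p * sigma q) = p" using d \<open>d \<noteq> 0\<close> by simp
    then have "p = smult (- 1 / d) ([:b, 1:] * [:- b - 1, 1:])"
      by (simp only: pq smult_neg)
    \<comment> \<open>The scaling parameter of this family is \<open>a = -1/d\<close>.\<close>
    moreover have "q = [:- 1 / (- 1 / d):]"
      using q[of d 1] d by (simp add: inv_sigma_simps)
    moreover have "- 1 / d \<noteq> 0" using \<open>d \<noteq> 0\<close> by simp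
    ultimately show thesis using that(3) b by blast
  qed
qed


section \<open>The modules of the skeleton\<close>

lemma usl2_hom_phi: "a \<noteq> 0 \<Longrightarrow> usl2_hom (phi (a, 1))"
  using is_phi_phi by (simp add: is_phi_def usl2_automorphism_iff)

lemma usl2_hom_tau: "usl2_hom tau"
  using is_tau_tau by (simp add: is_tau_def usl2_automorphism_iff)

lemma twist_phi_gens:
  assumes "a \<noteq> 0" "usl2_module act"
  shows "twist (phi (a, 1)) act (usl2_scalar c) v = act (usl2_scalar c) v"
    "twist (phi (a, 1)) act U_h v = act U_h v"
    "twist (phi (a, 1)) act U_e12 v = act (usl2_scalar a) (act U_e12 v)"
    "twist (phi (a, 1)) act U_e21 v = act (usl2_scalar (1 / a)) (act U_e21 v)"
  using assms is_phi_phi[of a] usl2_module.act_mult[of act]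
  by (simp_all add: twist_def is_phi_def usl2_automorphism_def)

lemma twist_tau_gens:
  assumes "usl2_module act"
  shows "twist tau act (usl2_scalar c) v = act (usl2_scalar c) v"
    "twist tau act U_h v = - act U_h v"
    "twist tau act U_e12 v = - act U_e21 v"
    "twist tau act U_e21 v = - act U_e12 v"
  using is_tau_tau usl2_module.minus_act[OF assms]
  by (simp_all add: twist_def is_tau_def usl2_automorphism_def)

text \<open>Here h already acts by multiplication and the twist only rescales the root vectors, so
  the identity is a coordinate map.\<close>

lemma realizes_M:
  assumes "a \<noteq> 0"
  shows "usl2_module (twist (phi (a, 1)) (mod_M b))"
    "realizes (twist (phi (a, 1)) (mod_M b)) (smult a [:b, 1:]) (smult (- 1 / a) [:-b, 1:]) id"
proof -
  note M = is_M_mod_M[of b, unfolded is_M_def]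
  show "usl2_module (twist (phi (a, 1)) (mod_M b))"
    using M by (simp add: usl2_module_twist usl2_hom_phi assms)
  show "realizes (twist (phi (a, 1)) (mod_M b)) (smult a [:b, 1:]) (smult (- 1 / a) [:-b, 1:]) id"
    using M by (simp add: realizes_def twist_phi_gens assms smult_add_right smult_diff_right)
qed

lemma realizes_M':
  assumes "a \<noteq> 0"
  shows "usl2_module (twist (phi (a, 1)) (mod_M' b))"
    "realizes (twist (phi (a, 1)) (mod_M' b)) [:a:] (smult (- 1 / a) ([:b + 1, 1:] * [:-b, 1:])) id"
proof -
  define g where "g = [:b + 1, 1:] * [:-b, 1:]"
  note M = is_M'_mod_M'[of b, unfolded is_M'_def, folded g_def]
  then have mod: "usl2_module (mod_M' b)" by simp
  then show "usl2_module (twist (phi (a, 1)) (mod_M' b))"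
    by (simp add: usl2_module_twist usl2_hom_phi assms)
  show "realizes (twist (phi (a, 1)) (mod_M' b)) [:a:]
      (smult (- 1 / a) ([:b + 1, 1:] * [:-b, 1:])) id"
    unfolding realizes_def g_def[symmetric]
    using M by (simp add: twist_phi_gens[OF assms mod])
qed

text \<open>Twisting by \<open>\<tau>\<close> makes $h$ act by $-h$, so the coordinate map is the reflection $f(h) \mapsto f(-h)$.\<close>

lemma realizes_M'_tau:
  assumes "a \<noteq> 0"
  shows "usl2_module (twist (phi (a, 1)) (twist tau (mod_M' b)))"
    "realizes (twist (phi (a, 1)) (twist tau (mod_M' b)))
      (smult a ([:b, 1:] * [:- b - 1, 1:])) [:- 1 / a:] (\<lambda>f. pcompose f [:0, -1:])"
proof -
  define g where "g = [:b + 1, 1:] * [:-b, 1:]"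
  note M = is_M'_mod_M'[of b, unfolded is_M'_def, folded g_def]
  then have mod': "usl2_module (mod_M' b)" by simp
  then have mod: "usl2_module (twist tau (mod_M' b))"
    by (simp add: usl2_module_twist usl2_hom_tau)
  then show "usl2_module (twist (phi (a, 1)) (twist tau (mod_M' b)))"
    by (simp add: usl2_module_twist usl2_hom_phi assms)
  let ?R = "\<lambda>f. pcompose f [:0, -1:] :: complex poly"
  have "?R (?R f) = f" for f
    by (simp add: pcompose_pCons flip: pcompose_assoc)
  then have "bij ?R" by (intro o_bij[of ?R]) (auto simp: fun_eq_iff)
  \<comment> \<open>Conjugation by the reflection reverses the direction of the shift.\<close>
  have S: "?R (sigma f) = inv sigma (?R f)" "?R (inv sigma f) = sigma (?R f)" for f
    by (simp_all add: inv_sigma sigma_def pcompose_pCons flip: pcompose_assoc)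
  \<comment> \<open>The reflection takes \<open>(h + b)(h - b - 1)\<close> to
    \<open>(h + b + 1)(h - b)\<close>. No sign appears, since the one from \<open>tau\<close>
    cancels the one in the action of \<open>e21\<close> on M'_b.\<close>
  have e12: "?R (smult a ([:b, 1:] * [:- b - 1, 1:]) * sigma f) =
      smult a (g * inv sigma (?R f))" for f
  proof -
    have "?R ([:b, 1:] * [:- b - 1, 1:]) = g"
      unfolding g_def pcompose_mult by (simp add: pcompose_pCons algebra_simps)
    then show ?thesis by (simp only: pcompose_mult pcompose_smult S mult_smult_left)
  qed
  have e21: "?R ([:- 1 / a:] * inv sigma f) = smult (1 / a) (- sigma (?R f))" for f
    unfolding pcompose_mult S by simp
  have h: "?R (pCons 0 f) = - ([:0, 1:] * ?R f)" for f
    by (simp add: pcompose_pCons)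
  show "realizes (twist (phi (a, 1)) (twist tau (mod_M' b)))
      (smult a ([:b, 1:] * [:- b - 1, 1:])) [:- 1 / a:] ?R"
    unfolding realizes_def e12 e21 h
    using M \<open>bij ?R\<close>
    by (simp add: twist_phi_gens[OF assms mod] twist_tau_gens[OF mod'] pcompose_add pcompose_smult)
qed

text \<open>The constant coefficient \<open>-b(b + 1)\<close> is all that M'_b retains of its
  parameter.\<close>

lemma M'_params_eq:
  assumes "[:b, 1:] * [:- b - 1, 1:] = [:c, 1:] * [:- c - 1, 1:]"
  shows "mod_M' b = mod_M' c"
proof (rule mod_M'_reflect)
  have "b * (- b - 1) = c * (- c - 1)"
    using arg_cong[OF assms, of "\<lambda>p. poly p 0"] by (simp add: mult.commute)
  then show "b * (b + 1) = c * (c + 1)" by (simp add: algebra_simps)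
qed

text \<open>Each candidate is listed together with its pair, so that comparing modules becomes
  comparing pairs of polynomials.\<close>

inductive skeleton_module ::
    "complex poly usl2_action \<Rightarrow> complex poly \<Rightarrow> complex poly \<Rightarrow> bool" where
  M: "a \<noteq> 0 \<Longrightarrow> skeleton_module (twist (phi (a, 1)) (mod_M b))
    (smult a [:b, 1:]) (smult (- 1 / a) [:-b, 1:])"
| M': "a \<noteq> 0 \<Longrightarrow> Re b \<ge> - 1/2 \<Longrightarrow> skeleton_module (twist (phi (a, 1)) (mod_M' b))
    [:a:] (smult (- 1 / a) ([:b + 1, 1:] * [:-b, 1:]))"
| M'_tau: "a \<noteq> 0 \<Longrightarrow> Re b \<ge> - 1/2 \<Longrightarrow> skeleton_module (twist (phi (a, 1)) (twist tau (mod_M' b)))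
    (smult a ([:b, 1:] * [:- b - 1, 1:])) [:- 1 / a:]"

lemma skeleton_module_realizes:
  assumes "skeleton_module N p q"
  shows "usl2_module N \<and> (\<exists>F. realizes N p q F)"
  using assms realizes_M realizes_M' realizes_M'_tau by cases blast+

lemma skeleton_module_complete:
  assumes "p * sigma q - q * inv sigma p = [:0, 2:]"
  obtains N where "skeleton_module N p q"
  by (rule relation_cases[OF assms]) (blast intro: skeleton_module.intros that)+

lemma skeleton_module_degree:
  fixes a b :: complex
  assumes "a \<noteq> 0"
  shows "degree (smult a [:b, 1:]) = 1" "degree [:a:] = 0"
    "degree (smult a ([:b, 1:] * [:- b - 1, 1:])) = 2"
  using assms by simp_all

text \<open>The degree of \<open>p\<close> excludes mixed families. Within a family the pair
  determines \<open>a\<close>, and determines \<open>b\<close> for M_b but only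
  \<open>b(b + 1)\<close> for the other two, which still fixes the action.\<close>

lemma skeleton_module_unique:
  assumes "skeleton_module N p q" "skeleton_module N' p q"
  shows "N = N'"
  using assms(1)
proof cases
  case (M a b)
  note N = this
  from assms(2) show ?thesis
  proof cases
    case (M a' b')
    then have "a = a'" "b = b'" using N by auto
    with M N show ?thesis by simp
  qed (use N in \<open>metis skeleton_module_degree zero_neq_one numeral_eq_one_iff num.distinct(1)\<close>)+
next
  case (M' a b)
  note N = this
  from assms(2) show ?thesis
  proof cases
    case (M' a' b')
    then have a: "a = a'" using N by simp
    have "smult (- 1 / a) ([:b + 1, 1:] * [:-b, 1:]) = smult (- 1 / a) ([:b' + 1, 1:] * [:-b', 1:])"
      using N M' a by simp
    then have "[:b + 1, 1:] * [:-b, 1:] = [:b' + 1, 1:] * [:-b', 1:]"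
      by (rule smult_left_cancel[rotated]) (simp add: N(4))
    \<comment> \<open>The parameters may differ; the quadratic factor in the defining formulas is
      the same.\<close>
    then have "mod_M' b = mod_M' b'" by (simp add: mod_M'_def is_M'_def)
    with M' N a show ?thesis by simp
  qed (use N in \<open>metis skeleton_module_degree zero_neq_one zero_neq_numeral\<close>)+
next
  case (M'_tau a b)
  note N = this
  from assms(2) show ?thesis
  proof cases
    case (M'_tau a' b')
    then have a: "a = a'" using N by simp
    have "smult a ([:b, 1:] * [:- b - 1, 1:]) = smult a ([:b', 1:] * [:- b' - 1, 1:])"
      using N M'_tau a by simp
    then have "mod_M' b = mod_M' b'"
      using N(4) by (intro M'_params_eq) (rule smult_left_cancel)
    with M'_tau N a show ?thesis by simp
  qed (use N in \<open>metis skeleton_module_degree zero_neq_one numeral_eq_one_iff num.distinct(1) zero_neq_numeral\<close>)+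
qed

theorem theorem11:
  shows "(\<forall>b. \<exists>!act. is_M b act) \<and> (\<forall>b. \<exists>!act. is_M' b act) \<and>
    is_skeleton_M TYPE('v::ab_group_add)
      ({twist (phi (a, 1)) (mod_M b) | a b. a \<noteq> 0} \<union>
       {twist (phi (a, 1)) (mod_M' b) | a b. a \<noteq> 0 \<and> Re b \<ge> - 1/2} \<union>
       {twist (phi (a, 1)) (twist tau (mod_M' b)) | a b. a \<noteq> 0 \<and> Re b \<ge> - 1/2})"
proof -
  have "{twist (phi (a, 1)) (mod_M b) | a b. a \<noteq> 0} \<union>
       {twist (phi (a, 1)) (mod_M' b) | a b. a \<noteq> 0 \<and> Re b \<ge> - 1/2} \<union>
       {twist (phi (a, 1)) (twist tau (mod_M' b)) | a b. a \<noteq> 0 \<and> Re b \<ge> - 1/2} =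
      {N. \<exists>p q. skeleton_module N p q}" (is "?S = _")
    by (auto simp only: skeleton_module.simps) blast+
  moreover have "is_skeleton_M TYPE('v) {N. \<exists>p q. skeleton_module N p q}"
    unfolding is_skeleton_M_def
  proof (intro conjI subsetI ballI)
    fix N assume "N \<in> {N. \<exists>p q. skeleton_module N p q}"
    then show "N \<in> cat_M"
      using skeleton_module_realizes realizes_in_cat_M by blast
  next
    fix act :: "'v usl2_action" assume act: "act \<in> cat_M"
    then have mod: "usl2_module act" by (simp add: cat_M_def)
    obtain p q F where F: "realizes act p q F" using act by (rule cat_M_realizes)
    obtain N where N: "skeleton_module N p q"
      using realizes_relation[OF F mod] by (rule skeleton_module_complete)
    show "\<exists>!N. N \<in> {N. \<exists>p q. skeleton_module N p q} \<and> usl2_iso act N"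
    proof (intro ex1I conjI CollectI exI)
      show "skeleton_module N p q" by (fact N)
      show "usl2_iso act N"
        using skeleton_module_realizes[OF N] realizes_iso[OF F mod] by blast
    next
      \<comment> \<open>A competing candidate inherits the pair of \<open>act\<close> along the
        isomorphism, and the pair singles out one candidate.\<close>
      fix N' assume "N' \<in> {N. \<exists>p q. skeleton_module N p q} \<and> usl2_iso act N'"
      then obtain p' q' where N': "skeleton_module N' p' q'" and "usl2_iso act N'" by blast
      then obtain G where "realizes N' p q G"
        using realizes_transport[OF F] by blast
      then have "p = p' \<and> q = q'"
        using skeleton_module_realizes[OF N'] realizes_unique by blast
      then show "N' = N" using N N' skeleton_module_unique by blast
    qed
  qed
  ultimately have "is_skeleton_M TYPE('v) ?S" by (simp only:)
  then show ?thesis using ex1_is_M ex1_is_M' by (intro conjI allI) 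
qed

end
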